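(* Consider the multisecretary problem with candidate-ability distribution $F$ that is $(\beta,\varepsilon_0,\delta)$-clustered for some fixed $\beta\in[0,\infty)$, $\varepsilon_0\in(0,1]$, $\delta\in[0,1]$. Fix $\eta>2$ and $\nu>0$, and assume the number of sample paths drawn by RAMS at time $t$ satisfies $K_t\ge(T-t+1)^{\eta+\nu}$. Then there is a constant $C\equiv C(F,\eta,\nu)<\infty$ such that for all $T\in\mathbb N$ and $B\in\mathbb N$, the regret of RAMS (in the variant with a static final phase described in the context) satisfies $$\mathrm{Regret}(B,T;\mathrm{RAMS})\le C\Big(1+\frac1\beta\Big)(\log T)^{\frac12+\frac{1}{2(\beta+1)}}T^{\frac12-\frac{1}{2(\beta+1)}}\mathbf 1\{\beta>0\}+C(\log T)^2\mathbf 1\{\beta=0\}+C\delta\sqrt{T\log T}+\frac{C\sqrt{\log(1/\varepsilon_0)}}{\varepsilon_0}.$$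
   Context: Multisecretary problem: horizon $T$, hiring budget $B$. Abilities $\theta_1,\dots,\theta_T\in[0,1]$ are i.i.d. from a distribution with CDF $F$. At each time $t$, after observing $\theta_t$, the decision maker irrevocably accepts ($a_t=1$) or rejects ($a_t=0$); at most $B$ acceptances in total; policies may be randomized and must be non-anticipating. $\mathrm{Regret}(B,T;\pi)=\mathbb E\big[\max\{\sum_t\theta_t a_t:a\in\{0,1\}^T,\sum_t a_t\le B\}\big]-\mathbb E[\sum_t\theta_t a_t^\pi]$. Clustered distributions: let $F^{-1}(q)=\inf\{v:F(v)\ge q\}$. $F$ is $(\beta,\varepsilon_0,\delta)$-clustered if there exist $n\ge0$ and gap quantiles $q_0^\star=0<q_1^\star<\dots<q_n^\star<q_{n+1}^\star=1$ such that (a) for all $i\in\{1,\dots,n+1\}$ and $q,\tilde q\in(q_{i-1}^\star,q_i^\star]$, $|F^{-1}(q)-F^{-1}(\tilde q)|\le C_0|q-\tilde q|^{1/(\beta+1)}+\delta$ for some constant $C_0<\infty$; (b) $q_i^\star-q_{i-1}^\star\ge\varepsilon_0$ for all $i$. RAMS (variant): let $B_1=B$, $\tilde T=\max\{0,T-\lfloor64\log(1/\varepsilon_0)/\varepsilon_0^2\rfloor\}$. For a budget $b$ and a finite sequence of abilities $\boldsymbol\theta$, let $V^{\mathrm{hs}}(b;\boldsymbol\theta)$ be the sum of its $\min\{b,\text{length}\}$ largest entries. For $t=1,\dots,\tilde T$: observe $\theta_t$; draw $K_t$ independent simulated futures $\tilde{\boldsymbol\theta}^{(i)}_{\ge t+1}$,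 each consisting of $T-t$ i.i.d. draws from $F$; accept has score $K_t^{-1}\sum_i[\theta_t+V^{\mathrm{hs}}(B_t-1;\tilde{\boldsymbol\theta}^{(i)}_{\ge t+1})]$ (available only if $B_t\ge1$), reject has score $K_t^{-1}\sum_iV^{\mathrm{hs}}(B_t;\tilde{\boldsymbol\theta}^{(i)}_{\ge t+1})$; take a feasible action with maximal score and update $B_{t+1}$. For $t=\tilde T+1,\dots,T$: use the fixed quantile threshold $p=1-B_{\tilde T+1}/(T-\tilde T)$: draw $X_t$ uniformly from $\{q\in[0,1]:F^{-1}(q)=\theta_t\}$ and accept iff $X_t\ge p$ and $B_t>0$. *)

theory Defs
  imports "HOL-Probability.Probability"
begin

section \<open>Ability distributions\<close>

text \<open>The ability distribution is a probability measure on the reals concentrated on the unit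
  interval; its distribution function \<open>F\<close> is \<^const>\<open>cdf\<close>.\<close>

text \<open>The infimum ranges over abilities in the unit interval. For \<open>q > 0\<close> this agrees with the
  infimum over all reals, since \<open>F\<close> vanishes on the negative reals; at \<open>q = 0\<close> it yields
  \<open>0\<close> rather than minus infinity.\<close>

definition quantile :: "real measure \<Rightarrow> real \<Rightarrow> real" where
  "quantile \<mu> q = Inf {v. 0 \<le> v \<and> v \<le> 1 \<and> q \<le> cdf \<mu> v}"

text \<open>The Hoelder constant \<open>C0\<close> is an argument, not existentially quantified, so that a bound can
  depend on it without depending on \<open>\<beta>\<close>, \<open>\<epsilon>0\<close> or \<open>\<delta>\<close>. Being
  \<open>(\<beta>, \<epsilon>0, \<delta>)\<close>-clustered means satisfying this predicate for some \<open>C0\<close>.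
  Note that \<open>0 powr a = 0\<close>.\<close>

definition clustered :: "real \<Rightarrow> real \<Rightarrow> real \<Rightarrow> real \<Rightarrow> real measure \<Rightarrow> bool" where
  "clustered C0 \<beta> \<epsilon>0 \<delta> \<mu> \<longleftrightarrow>
    (\<exists>(n::nat) (g :: nat \<Rightarrow> real).
       g 0 = 0 \<and> g (n + 1) = 1 \<and> (\<forall>i\<in>{1..n+1}. g (i - 1) < g i) \<and>
       (\<forall>i\<in>{1..n+1}. \<forall>q\<in>{g (i - 1)<..g i}. \<forall>q'\<in>{g (i - 1)<..g i}.
          \<bar>quantile \<mu> q - quantile \<mu> q'\<bar> \<le> C0 * \<bar>q - q'\<bar> powr (1 / (\<beta> + 1)) + \<delta>) \<and>
       (\<forall>i\<in>{1..n+1}. g i - g (i - 1) \<ge> \<epsilon>0))"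

section \<open>The multisecretary problem\<close>

text \<open>Sources of randomness, all independent: the ability observed at time \<open>t\<close>; the
  \<open>j\<close>-th ability in the \<open>i\<close>-th future simulated at time \<open>t\<close>
  (\<open>Simulated t i j\<close>); and an auxiliary uniform variable available from time \<open>t\<close> on,
  through which policies may randomize.\<close>

datatype source = Ability nat | Simulated nat nat nat | Auxiliary nat

fun stage :: "source \<Rightarrow> nat" where
  "stage (Ability t) = t"
| "stage (Simulated t i j) = t"
| "stage (Auxiliary t) = t"

fun source_law :: "real measure \<Rightarrow> source \<Rightarrow> real measure" where
  "source_law \<mu> (Ability t) = \<mu>"
| "source_law \<mu> (Simulated t i j) = \<mu>"
| "source_law \<mu> (Auxiliary t) = uniform_measure lborel {0..1}"

type_synonym outcome = "source \<Rightarrow> real"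

definition outcome_space :: "real measure \<Rightarrow> outcome measure" where
  "outcome_space \<mu> = PiM UNIV (source_law \<mu>)"

text \<open>The sigma-algebra generated by all sources revealed up to and including time \<open>t\<close>.\<close>

definition history :: "real measure \<Rightarrow> nat \<Rightarrow> outcome measure" where
  "history \<mu> t =
     vimage_algebra (space (outcome_space \<mu>)) (\<lambda>\<omega>. restrict \<omega> {x. stage x \<le> t})
       (PiM {x. stage x \<le> t} (source_law \<mu>))"

text \<open>\<open>\<pi> t \<omega>\<close> holds iff the candidate at time \<open>t\<close> is accepted.\<close>

type_synonym policy = "nat \<Rightarrow> outcome \<Rightarrow> bool"

definition nonanticipating :: "real measure \<Rightarrow> nat \<Rightarrow> policy \<Rightarrow> bool" where
  "nonanticipating \<mu> T \<pi> \<longleftrightarrow> (\<forall>t\<in>{1..T}. \<pi> t \<in> measurable (history \<mu> t) (count_space UNIV))"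

definition remaining_budget :: "nat \<Rightarrow> policy \<Rightarrow> nat \<Rightarrow> outcome \<Rightarrow> nat" where
  "remaining_budget B \<pi> t \<omega> = B - card {s\<in>{1..<t}. \<pi> s \<omega>}"

definition hindsight_optimum :: "nat \<Rightarrow> nat \<Rightarrow> outcome \<Rightarrow> real" where
  "hindsight_optimum B T \<omega> =
     Max ((\<lambda>A. \<Sum>t\<in>A. \<omega> (Ability t)) ` {A. A \<subseteq> {1..T} \<and> card A \<le> B})"

definition regret :: "real measure \<Rightarrow> nat \<Rightarrow> nat \<Rightarrow> policy \<Rightarrow> real" where
  "regret \<mu> B T \<pi> =
     (\<integral>\<omega>. hindsight_optimum B T \<omega> \<partial>outcome_space \<mu>) -
     (\<integral>\<omega>. (\<Sum>t=1..T. \<omega> (Ability t) * of_bool (\<pi> t \<omega>)) \<partial>outcome_space \<mu>)"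

section \<open>RAMS with a static final phase\<close>

definition V_hs :: "nat \<Rightarrow> real list \<Rightarrow> real" where
  "V_hs b xs = sum_list (take b (rev (sort xs)))"

definition simulated_future :: "nat \<Rightarrow> nat \<Rightarrow> nat \<Rightarrow> outcome \<Rightarrow> real list" where
  "simulated_future T t i \<omega> = map (\<lambda>j. \<omega> (Simulated t i j)) [t+1..<T+1]"

definition accept_score :: "(nat \<Rightarrow> nat) \<Rightarrow> nat \<Rightarrow> nat \<Rightarrow> nat \<Rightarrow> outcome \<Rightarrow> real" where
  "accept_score K T b t \<omega> =
     (\<Sum>i=1..K t. \<omega> (Ability t) + V_hs (b - 1) (simulated_future T t i \<omega>)) / real (K t)"

definition reject_score :: "(nat \<Rightarrow> nat) \<Rightarrow> nat \<Rightarrow> nat \<Rightarrow> nat \<Rightarrow> outcome \<Rightarrow> real" where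
  "reject_score K T b t \<omega> =
     (\<Sum>i=1..K t. V_hs b (simulated_future T t i \<omega>)) / real (K t)"

text \<open>Truncated subtraction on the naturals supplies the maximum with \<open>0\<close>.\<close>

definition switch_time :: "real \<Rightarrow> nat \<Rightarrow> nat" where
  "switch_time \<epsilon>0 T = T - nat \<lfloor>64 * ln (1 / \<epsilon>0) / \<epsilon>0\<^sup>2\<rfloor>"

text \<open>A uniform draw from the interval of quantiles at which the quantile function equals
  \<open>\<theta>\<close>, obtained by rescaling \<open>u\<close>, which is uniform on the unit interval. The interval
  may be a single point; it is empty only for a null set of abilities.\<close>

definition quantile_draw :: "real measure \<Rightarrow> real \<Rightarrow> real \<Rightarrow> real" where
  "quantile_draw \<mu> \<theta> u =
     (let S = {q. 0 \<le> q \<and> q \<le> 1 \<and> quantile \<mu> q = \<theta>} in Inf S + u * (Sup S - Inf S))"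

text \<open>Ties between the two scores may be broken by any non-anticipating, possibly randomized
  rule, so RAMS is a class of policies.\<close>

definition rams :: "real measure \<Rightarrow> real \<Rightarrow> (nat \<Rightarrow> nat) \<Rightarrow> nat \<Rightarrow> nat \<Rightarrow> policy \<Rightarrow> bool" where
  "rams \<mu> \<epsilon>0 K B T \<pi> \<longleftrightarrow>
     nonanticipating \<mu> T \<pi> \<and>
     (\<forall>\<omega>\<in>space (outcome_space \<mu>).
        (\<forall>t\<in>{1..switch_time \<epsilon>0 T}.
           let b = remaining_budget B \<pi> t \<omega> in
             (\<pi> t \<omega> \<longrightarrow> b \<ge> 1 \<and> accept_score K T b t \<omega> \<ge> reject_score K T b t \<omega>) \<and>
             (\<not> \<pi> t \<omega> \<longrightarrow> b = 0 \<or> reject_score K T b t \<omega> \<ge> accept_score K T b t \<omega>)) \<and>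
        (let p = 1 - real (remaining_budget B \<pi> (switch_time \<epsilon>0 T + 1) \<omega>) /
                       real (T - switch_time \<epsilon>0 T)
         in \<forall>t\<in>{switch_time \<epsilon>0 T + 1..T}.
              \<pi> t \<omega> \<longleftrightarrow>
                quantile_draw \<mu> (\<omega> (Ability t)) (\<omega> (Auxiliary t)) \<ge> p \<and>
                remaining_budget B \<pi> t \<omega> > 0))"

end

theory Submission
  imports Defs
begin

text \<open>Let \<open>V b\<close> be the sum of the \<open>b\<close> largest abilities among the candidates that are still to come.
Comparing \<open>V\<close> before and after each decision splits the regret into the losses of the single
decisions of the adaptive phase and the loss of the static phase. Write \<open>Z = V b - V (b - 1)\<close> for the
value of the last unit of budget, that is, the \<open>b\<close>-th largest future ability. Accepting \<open>\<theta>\<close> loses \<open>max 0 (Z - \<theta>)\<close>, rejecting it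
loses \<open>max 0 (\<theta> - Z)\<close>, and the two losses differ by exactly \<open>Z - \<theta>\<close>. Hence the loss of
RAMS, with decision \<open>a\<close>, exceeds that of any other rule, with decision \<open>c\<close>, by
\<open>(a - c) * (Z - \<theta>)\<close>. RAMS compares \<open>\<theta>\<close> with the average \<open>Zhat\<close> of \<open>Z\<close> over the simulated
futures, so \<open>(a - c) * (Zhat - \<theta>)\<close> is not positive, and at most
\<open>(a - c) * (Z - m) + \<bar>m - Zhat\<bar>\<close> remains, where \<open>m\<close> is the mean of \<open>Z\<close> (lemma
\<open>step_loss_le\<close>). The first summand has mean zero, because \<open>a\<close> and \<open>c\<close> depend on the past
and \<open>Z\<close> on the future. The second is at most \<open>1 / sqrt K\<close> on average, and these terms are
summable since \<open>\<eta> > 2\<close>.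

It remains to exhibit a good rule for comparison, which may use the true law. The uniform quantile draw turns
abilities into independent uniform ranks. With \<open>s\<close> candidates left, the rank of the \<open>b\<close>-th largest
ability lies within \<open>w = sqrt (ln T / s)\<close> of \<open>p = 1 - b / s\<close> with high probability, by Hoeffding's inequality. The
rule for comparison accepts ranks above the gap nearest to \<open>p\<close> if that gap is within \<open>w\<close> of
\<open>p\<close>, and ranks above \<open>p\<close> otherwise. Then an erroneous decision never costs the height of a gap: the
current ability and the \<open>b\<close>-th largest future one lie in the same cluster, at rank distance at most
\<open>2 * w\<close>, unless the rank of the \<open>b\<close>-th largest ability deviates from \<open>p\<close> by \<open>w\<close> or by
\<open>\<epsilon>0 / 2\<close>, half the minimal width of a cluster (lemma \<open>cluster_threshold\<close>). As the candidate's rank falls into the critical window with probability at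
most \<open>2 * w\<close>, a step costs on the order of \<open>w * (w powr (1 / (\<beta> + 1)) + \<delta>)\<close>, and summing over
\<open>s\<close> gives the three terms of the bound that depend on \<open>T\<close>. The deviations by half a cluster
width are rare enough to be summable as long as at least \<open>64 * ln (1 / \<epsilon>0) / \<epsilon>0\<^sup>2 - 1\<close> candidates are left.

The static phase covers the last candidates, at most \<open>64 * ln (1 / \<epsilon>0) / \<epsilon>0\<^sup>2\<close> of them. Its loss
is controlled by the standard deviation of the number of ranks above the fixed threshold, hence by the square root
of the length of the phase (lemma \<open>expectation_final_bound_le\<close>), which is the fourth term.\<close>

section \<open>Optimal selection from a finite list\<close>

text \<open>The dynamic programming recursion for selecting at most \<open>b\<close> entries of maximal sum. Unlike a sum of
sorted entries it is visibly measurable in the entries and follows the candidates in order of arrival.\<close>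
fun opt :: "nat \<Rightarrow> real list \<Rightarrow> real" where
  "opt b [] = 0"
| "opt 0 xs = 0"
| "opt (Suc b) (x # xs) = max (x + opt b xs) (opt (Suc b) xs)"

lemma opt_0 [simp]: "opt 0 xs = 0"
  by (cases xs) auto

lemma sum_le_opt:
  assumes "distinct js" "A \<subseteq> set js" "card A \<le> b"
  shows "sum f A \<le> opt b (map f js)"
  using assms
proof (induction js arbitrary: A b)
  case (Cons j js)
  have fin: "finite A" using Cons.prems finite_subset by blast
  show ?case
  proof (cases b)
    case 0
    with Cons.prems fin show ?thesis by simp
  next
    case (Suc b')
    show ?thesis
    proof (cases "j \<in> A")
      case True
      have "sum f (A - {j}) \<le> opt b' (map f js)"
        using Cons.prems Suc True by (intro Cons.IH) auto
      then show ?thesis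
        using True fin Suc by (simp add: sum.remove)
    next
      case False
      have "sum f A \<le> opt (Suc b') (map f js)"
        using Cons.prems Suc False by (intro Cons.IH) auto
      then show ?thesis using Suc by simp
    qed
  qed
qed simp

lemma hindsight_optimum_le_opt:
  "hindsight_optimum B T \<omega> \<le> opt B (map (\<lambda>t. \<omega> (Ability t)) [1..<T+1])"
proof -
  have "finite {A. A \<subseteq> {1..T} \<and> card A \<le> B}" by simp
  moreover have "{} \<in> {A. A \<subseteq> {1..T} \<and> card A \<le> B}" by simp
  ultimately show ?thesis
    unfolding hindsight_optimum_def
    by (subst Max_le_iff) (auto simp del: upt_Suc simp: atLeastLessThanSuc_atLeastAtMost intro!: sum_le_opt)
qed

text \<open>Weak linear programming duality, with \<open>v\<close> as the price of a unit of budget.\<close>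
lemma opt_le_excess:
  assumes "v \<ge> 0"
  shows "opt b xs \<le> (\<Sum>x\<leftarrow>xs. max 0 (x - v)) + v * b"
proof (induction b xs rule: opt.induct)
  case (3 b x xs)
  then show ?case using assms by (auto simp: algebra_simps max_def)
qed (auto simp: assms intro!: add_nonneg_nonneg sum_list_nonneg)

text \<open>Insertion from the large end, so that the sums of the largest entries can be followed by induction on the sorted list.\<close>
fun insert_desc :: "real \<Rightarrow> real list \<Rightarrow> real list" where
  "insert_desc x [] = [x]"
| "insert_desc x (y # ys) = (if y \<le> x then x # y # ys else y # insert_desc x ys)"

lemma set_insert_desc: "set (insert_desc x ys) = insert x (set ys)"
  by (induction ys) auto

lemma rev_sort_Cons: "rev (sort (x # xs)) = insert_desc x (rev (sort xs))"
proof -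
  have mset: "mset (insert_desc x ys) = add_mset x (mset ys)" for ys
    by (induction ys) auto
  have "sorted_wrt (\<ge>) ys \<Longrightarrow> sorted_wrt (\<ge>) (insert_desc x ys)" for ys
    by (induction ys) (auto simp: set_insert_desc)
  then have "sorted (rev (insert_desc x (rev (sort xs))))"
    by (simp add: sorted_wrt_rev)
  then have "sort (x # xs) = rev (insert_desc x (rev (sort xs)))"
    by (intro properties_for_sort) (simp_all add: mset)
  then show ?thesis by simp
qed

lemma sum_take_Suc_le:
  assumes "\<And>z. z \<in> set zs \<Longrightarrow> z \<le> x" "0 \<le> (x::real)"
  shows "sum_list (take (Suc b) zs) \<le> x + sum_list (take b zs)"
  using assms by (cases "b < length zs") (auto simp: take_Suc_conv_app_nth)

lemma sum_take_insert_desc: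
  assumes "sorted_wrt (\<ge>) ys" "0 \<le> x" "\<And>y. y \<in> set ys \<Longrightarrow> 0 \<le> y"
  shows "sum_list (take (Suc b) (insert_desc x ys)) =
    max (x + sum_list (take b ys)) (sum_list (take (Suc b) ys))"
  using assms
proof (induction ys arbitrary: b)
  case (Cons y ys)
  show ?case
  proof (cases "y \<le> x")
    case True
    have "sum_list (take (Suc b) (y # ys)) \<le> x + sum_list (take b (y # ys))"
      using Cons.prems True by (intro sum_take_Suc_le) auto
    with True show ?thesis by (simp add: max_def)
  next
    case False
    show ?thesis
    proof (cases b)
      case 0
      with False show ?thesis by simp
    next
      case (Suc b')
      with False Cons show ?thesis by (auto simp: max_def)
    qed
  qed
qed simp

lemma V_hs_eq_opt:
  assumes "\<And>x. x \<in> set xs \<Longrightarrow> 0 \<le> x"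
  shows "V_hs b xs = opt b xs"
  using assms
proof (induction b xs rule: opt.induct)
  case (3 b x xs)
  have "V_hs (Suc b) (x # xs) = max (x + V_hs b xs) (V_hs (Suc b) xs)"
    unfolding V_hs_def rev_sort_Cons using 3(3)
    by (intro sum_take_insert_desc) (auto simp: sorted_wrt_rev)
  with 3 show ?case by simp
qed (auto simp: V_hs_def)

text \<open>For \<open>b \<ge> 1\<close> and nonnegative entries this is the \<open>b\<close>-th largest entry, or zero if there are fewer than
\<open>b\<close> entries.\<close>
definition marginal :: "nat \<Rightarrow> real list \<Rightarrow> real" where
  "marginal b xs = opt b xs - opt (b - 1) xs"

lemma marginal_eq:
  assumes "\<And>x. x \<in> set xs \<Longrightarrow> 0 \<le> x" "1 \<le> b"
  shows "marginal b xs = (if b \<le> length xs then rev (sort xs) ! (b - 1) else 0)"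
proof -
  obtain b' where b: "b = Suc b'" using assms(2) by (cases b) auto
  have "marginal b xs = V_hs b xs - V_hs b' xs"
    using assms(1) b by (simp add: marginal_def V_hs_eq_opt)
  also have "\<dots> = (if b \<le> length xs then rev (sort xs) ! (b - 1) else 0)"
    using b by (auto simp: V_hs_def take_Suc_conv_app_nth)
  finally show ?thesis .
qed

lemma marginal_bounds:
  assumes "\<And>x. x \<in> set xs \<Longrightarrow> 0 \<le> x \<and> x \<le> 1" "1 \<le> b"
  shows "0 \<le> marginal b xs" "marginal b xs \<le> 1"
proof -
  have "rev (sort xs) ! (b - 1) \<in> set xs" if "b \<le> length xs"
    using that assms(2) nth_mem[of "b - 1" "rev (sort xs)"] by simp
  then show "0 \<le> marginal b xs" "marginal b xs \<le> 1"
    using assms by (auto simp: marginal_eq)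
qed

lemma opt_bounds:
  assumes "\<forall>x\<in>set xs. 0 \<le> x \<and> x \<le> 1"
  shows "0 \<le> opt b xs \<and> opt b xs \<le> length xs"
  using assms
  by (induction b xs rule: opt.induct) auto

lemma marginal_map_mono:
  fixes f :: "real \<Rightarrow> real"
  assumes "mono f" "\<And>u. 0 \<le> f u" "1 \<le> b" "b \<le> length us"
  shows "marginal b (map f us) = f (rev (sort us) ! (b - 1))"
proof -
  have "sort (map f us) = map f (sort us)"
    by (intro properties_for_sort) (use assms(1) in \<open>auto simp: sorted_map monoD intro: sorted_wrt_mono_rel[OF _ sorted_sort]\<close>)
  moreover have "marginal b (map f us) = rev (sort (map f us)) ! (b - 1)"
    using assms by (subst marginal_eq) auto
  ultimately show ?thesis using assms by (simp add: rev_map)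
qed

text \<open>Ranks of order statistics enter only through counts: the two lemmas below translate bounds on the \<open>b\<close>-th
largest entry into bounds on the number of entries in an upward closed set, which is a sum of independent indicators
if the entries are independent.\<close>
lemma le_order_stat_imp_count:
  fixes us :: "'a::linorder list"
  assumes "1 \<le> b" "b \<le> length us" "P (rev (sort us) ! (b - 1))" "\<And>u v. P u \<Longrightarrow> u \<le> v \<Longrightarrow> P v"
  shows "b \<le> length (filter P us)"
proof -
  let ?ys = "rev (sort us)"
  have "P y" if "y \<in> set (take b ?ys)" for y
  proof -
    obtain i where "i < length (take b ?ys)" "take b ?ys ! i = y"
      using \<open>y \<in> set (take b ?ys)\<close> unfolding in_set_conv_nth by blast
    then have i: "i < b" "i < length us" "y = ?ys ! i"
      using assms(2) by simp_all
    have "sorted_wrt (\<ge>) ?ys" by (simp add: sorted_wrt_rev)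
    then have "?ys ! (b - 1) \<le> ?ys ! i"
      using i assms(1,2) by (cases "i = b - 1") (auto simp: sorted_wrt_iff_nth_less)
    with assms(3,4) i show ?thesis by blast
  qed
  then have "filter P (take b ?ys) = take b ?ys" by (simp add: filter_id_conv)
  then have "b \<le> length (filter P (take b ?ys))" using assms(2) by simp
  also have "\<dots> \<le> length (filter P (take b ?ys)) + length (filter P (drop b ?ys))" by simp
  also have "\<dots> = length (filter P ?ys)"
    by (metis append_take_drop_id filter_append length_append)
  also have "\<dots> = length (filter P us)"
    by (metis mset_filter mset_rev mset_sort size_mset)
  finally show ?thesis .
qed

lemma order_stat_imp_count_less:
  fixes us :: "'a::linorder list"
  assumes "1 \<le> b" "b \<le> length us" "\<not> P (rev (sort us) ! (b - 1))" "\<And>u v. P u \<Longrightarrow> u \<le> v \<Longrightarrow> P v"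
  shows "length (filter P us) < b"
proof -
  let ?ys = "rev (sort us)"
  have "\<not> P y" if "y \<in> set (drop (b - 1) ?ys)" for y
  proof -
    obtain k where "k < length (drop (b - 1) ?ys)" "drop (b - 1) ?ys ! k = y"
      using \<open>y \<in> set (drop (b - 1) ?ys)\<close> unfolding in_set_conv_nth by blast
    then have i: "b - 1 \<le> b - 1 + k" "b - 1 + k < length us" "y = ?ys ! (b - 1 + k)"
      using assms(2) by (simp_all del: One_nat_def)
    define i where "i = b - 1 + k"
    note i = i[folded i_def]
    have "sorted_wrt (\<ge>) ?ys" by (simp add: sorted_wrt_rev)
    then have "?ys ! (b - 1) \<ge> ?ys ! i"
      using i assms(1,2) by (cases "i = b - 1") (auto simp: sorted_wrt_iff_nth_less)
    with assms(3,4) i show ?thesis by blast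
  qed
  then have "filter P (drop (b - 1) ?ys) = []" by (simp add: filter_empty_conv)
  then have "length (filter P (take (b - 1) ?ys)) = length (filter P ?ys)"
    by (metis append_take_drop_id filter_append append_Nil2)
  also have "\<dots> = length (filter P us)"
    by (metis mset_filter mset_rev mset_sort size_mset)
  finally have "length (filter P us) \<le> b - 1"
    using length_filter_le[of P "take (b - 1) ?ys"] by simp
  then show ?thesis using assms(1) by linarith
qed

section \<open>Independent blocks of coordinates\<close>

locale ability_law =
  fixes \<mu> :: "real measure"
  assumes real_distribution: "real_distribution \<mu>"
    and support: "measure \<mu> {0..1} = 1"
begin

sublocale real_distribution \<mu>
  by (rule real_distribution)

abbreviation \<Omega> :: "outcome measure" where "\<Omega> \<equiv> outcome_space \<mu>"

lemma prob_space_source_law: "prob_space (source_law \<mu> x)"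
  by (cases x) (auto intro!: prob_space_uniform_measure prob_space_axioms)

lemma sets_source_law [simp, measurable_cong]: "sets (source_law \<mu> x) = sets borel"
  by (cases x) auto

lemma space_source_law [simp]: "space (source_law \<mu> x) = UNIV"
  by (cases x) auto

sublocale outcome: prob_space \<Omega>
  unfolding outcome_space_def by (intro prob_space_PiM prob_space_source_law)

lemma space_\<Omega> [simp]: "space \<Omega> = UNIV"
  by (simp add: outcome_space_def space_PiM)

lemma prob_UNIV [simp]: "outcome.prob UNIV = 1"
  using outcome.prob_space by simp

text \<open>The sigma-algebra generated by the sources in \<open>I\<close>. Every use of independence below is an instance of
disjoint sets of sources.\<close>
definition coords :: "source set \<Rightarrow> outcome measure" where
  "coords I = vimage_algebra UNIV (\<lambda>\<omega>. restrict \<omega> I) (PiM I (source_law \<mu>))"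

lemma space_coords [simp]: "space (coords I) = UNIV"
  by (simp add: coords_def)

lemma measurable_restrict_coords: "(\<lambda>\<omega>. restrict \<omega> I) \<in> measurable (coords I) (PiM I (source_law \<mu>))"
  unfolding coords_def by (rule measurable_vimage_algebra1) (auto simp: space_PiM)

lemma measurable_coordinate:
  assumes "x \<in> I"
  shows "(\<lambda>\<omega>. \<omega> x) \<in> borel_measurable (coords I)"
proof -
  have "(\<lambda>\<omega>. restrict \<omega> I x) \<in> measurable (coords I) (source_law \<mu> x)"
    by (rule measurable_compose[OF measurable_restrict_coords measurable_component_singleton]) fact
  also have "(\<lambda>\<omega>. restrict \<omega> I x) = (\<lambda>\<omega>. \<omega> x)" using assms by auto
  finally show ?thesis by (simp cong: measurable_cong_sets)
qed

lemma measurable_coordinate_\<Omega> [measurable]: "(\<lambda>\<omega>. \<omega> x) \<in> borel_measurable \<Omega>"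
proof -
  have "(\<lambda>\<omega>. \<omega> x) \<in> measurable \<Omega> (source_law \<mu> x)"
    unfolding outcome_space_def by (rule measurable_component_singleton) simp
  then show ?thesis by (simp cong: measurable_cong_sets)
qed

lemma sets_coords_subset:
  assumes "\<And>x. x \<in> I \<Longrightarrow> (\<lambda>\<omega>. \<omega> x) \<in> borel_measurable M" "space M = UNIV"
  shows "sets (coords I) \<subseteq> sets M"
proof -
  have "(\<lambda>\<omega>. restrict \<omega> I) \<in> measurable M (PiM I (source_law \<mu>))"
    using assms by (intro measurable_restrict) (simp cong: measurable_cong_sets)
  then have "id \<in> measurable M (coords I)"
    unfolding coords_def by (intro measurable_vimage_algebra2) auto
  from measurable_sets[OF this] show ?thesis using assms(2) by auto
qed

lemma measurable_coords_mono:
  assumes "X \<in> measurable (coords I) N" "I \<subseteq> J"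
  shows "X \<in> measurable (coords J) N"
proof -
  have "sets (coords I) \<subseteq> sets (coords J)"
    using assms(2) by (intro sets_coords_subset) (auto intro: measurable_coordinate)
  then show ?thesis using assms(1) by (auto simp: measurable_def)
qed

lemma measurable_coords_\<Omega>:
  assumes "X \<in> measurable (coords I) N"
  shows "X \<in> measurable \<Omega> N"
proof -
  have "sets (coords I) \<subseteq> sets \<Omega>" by (intro sets_coords_subset) auto
  then show ?thesis using assms by (auto simp: measurable_def)
qed

lemma history_eq_coords: "history \<mu> t = coords {x. stage x \<le> t}"
  by (simp add: history_def coords_def)

lemma indep_sets_coords:
  assumes "disjoint_family_on K L"
  shows "outcome.indep_sets (\<lambda>j. sets (coords (K j))) L"
proof -
  have "distr \<Omega> (source_law \<mu> x) (\<lambda>\<omega>. \<omega> x) = source_law \<mu> x" for x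
    unfolding outcome_space_def by (rule distr_PiM_component) (auto simp: prob_space_source_law)
  then have "distr \<Omega> (PiM UNIV (source_law \<mu>)) (\<lambda>\<omega>. \<lambda>x\<in>UNIV. \<omega> x)
      = PiM UNIV (\<lambda>x. distr \<Omega> (source_law \<mu> x) (\<lambda>\<omega>. \<omega> x))"
    by (simp add: outcome_space_def restrict_UNIV)
  moreover have "(\<lambda>\<omega>. \<omega> x) \<in> measurable \<Omega> (source_law \<mu> x)" for x
    by (simp cong: measurable_cong_sets)
  ultimately have "outcome.indep_vars (source_law \<mu>) (\<lambda>x \<omega>. \<omega> x) UNIV"
    by (subst outcome.indep_vars_iff_distr_eq_PiM) auto
  from outcome.indep_vars_restrict[OF this _ assms]
  have "outcome.indep_vars (\<lambda>j. PiM (K j) (source_law \<mu>)) (\<lambda>j \<omega>. restrict \<omega> (K j)) L"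
    by simp
  then have "outcome.indep_sets (\<lambda>j. {(\<lambda>\<omega>. restrict \<omega> (K j)) -` A \<inter> space \<Omega> |A. A \<in> sets (PiM (K j) (source_law \<mu>))}) L"
    unfolding outcome.indep_vars_def2 by blast
  moreover have "sets (coords I) = {(\<lambda>\<omega>. restrict \<omega> I) -` A \<inter> space \<Omega> |A. A \<in> sets (PiM I (source_law \<mu>))}" for I
    unfolding coords_def by (subst sets_vimage_algebra2) (auto simp: space_PiM)
  ultimately show ?thesis by simp
qed

lemma indep_vars_coords:
  assumes "disjoint_family_on K L" "\<And>j. j \<in> L \<Longrightarrow> X j \<in> measurable (coords (K j)) (N j)"
  shows "outcome.indep_vars N X L"
  unfolding outcome.indep_vars_def2
proof (intro conjI ballI)
  show "X j \<in> measurable \<Omega> (N j)" if "j \<in> L" for j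
    using assms(2)[OF that] by (rule measurable_coords_\<Omega>)
  show "outcome.indep_sets (\<lambda>j. {X j -` A \<inter> space \<Omega> |A. A \<in> sets (N j)}) L"
    using measurable_sets[OF assms(2)]
    by (intro outcome.indep_sets_mono_sets[OF indep_sets_coords[OF assms(1)]]) auto
qed

lemma expectation_mult:
  fixes X Y :: "outcome \<Rightarrow> real"
  assumes "I \<inter> J = {}" "X \<in> borel_measurable (coords I)" "Y \<in> borel_measurable (coords J)"
    and "integrable \<Omega> X" "integrable \<Omega> Y"
  shows "outcome.expectation (\<lambda>\<omega>. X \<omega> * Y \<omega>) = outcome.expectation X * outcome.expectation Y"
    and "integrable \<Omega> (\<lambda>\<omega>. X \<omega> * Y \<omega>)"
proof -
  have "outcome.indep_vars (case_bool borel borel) (case_bool X Y) UNIV"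
    by (rule indep_vars_coords[where K = "case_bool I J"])
      (use assms in \<open>auto simp: disjoint_family_on_def split: bool.splits\<close>)
  then have ind: "outcome.indep_var borel X borel Y"
    unfolding outcome.indep_var_def .
  show "outcome.expectation (\<lambda>\<omega>. X \<omega> * Y \<omega>) = outcome.expectation X * outcome.expectation Y"
    by (rule outcome.indep_var_lebesgue_integral[OF ind]) fact+
  show "integrable \<Omega> (\<lambda>\<omega>. X \<omega> * Y \<omega>)"
    by (rule outcome.indep_var_integrable[OF ind]) fact+
qed

lemma integrable_bounded:
  fixes X :: "outcome \<Rightarrow> real"
  assumes "X \<in> borel_measurable \<Omega>" "AE \<omega> in \<Omega>. \<bar>X \<omega>\<bar> \<le> c"
  shows "integrable \<Omega> X"
  using assms by (intro outcome.integrable_const_bound[where B = c]) auto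

text \<open>Here \<open>n\<close> is the number of summands. The variance of the sum is at most \<open>n\<close>, because the mixed terms vanish; the passage to
  the first moment uses \<open>2 \<bar>x\<bar> \<le> x\<^sup>2 / \<surd>n + \<surd>n\<close>.\<close>

lemma expectation_abs_sum_le_sqrt:
  fixes X :: "'i \<Rightarrow> outcome \<Rightarrow> real"
  assumes "finite L" "disjoint_family_on K L"
    and meas: "\<And>j. j \<in> L \<Longrightarrow> X j \<in> borel_measurable (coords (K j))"
    and bound: "\<And>j. j \<in> L \<Longrightarrow> AE \<omega> in \<Omega>. \<bar>X j \<omega>\<bar> \<le> 1"
    and zero: "\<And>j. j \<in> L \<Longrightarrow> outcome.expectation (X j) = 0"
  shows "outcome.expectation (\<lambda>\<omega>. \<bar>\<Sum>j\<in>L. X j \<omega>\<bar>) \<le> sqrt (card L)"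
proof (cases "L = {}")
  case False
  define n where "n = real (card L)"
  have n: "n > 0" using False assms(1) by (simp add: n_def card_gt_0_iff)
  have measO: "X j \<in> borel_measurable \<Omega>" if "j \<in> L" for j
    using meas[OF that] by (rule measurable_coords_\<Omega>)
  have int: "integrable \<Omega> (X j)" if "j \<in> L" for j
    using measO[OF that] bound[OF that] by (rule integrable_bounded)
  have prod: "integrable \<Omega> (\<lambda>\<omega>. X i \<omega> * X j \<omega>)" 
    "outcome.expectation (\<lambda>\<omega>. X i \<omega> * X j \<omega>) \<le> of_bool (i = j)" if "i \<in> L" "j \<in> L" for i j
  proof -
    have ae: "AE \<omega> in \<Omega>. \<bar>X i \<omega> * X j \<omega>\<bar> \<le> 1"
      using bound[OF that(1)] bound[OF that(2)]
      by eventually_elim (auto simp: abs_mult intro: mult_le_one)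
    show *: "integrable \<Omega> (\<lambda>\<omega>. X i \<omega> * X j \<omega>)"
      by (rule integrable_bounded[OF _ ae]) (use measO that in measurable)
    show "outcome.expectation (\<lambda>\<omega>. X i \<omega> * X j \<omega>) \<le> of_bool (i = j)"
    proof (cases "i = j")
      case True
      have "outcome.expectation (\<lambda>\<omega>. X i \<omega> * X j \<omega>) \<le> outcome.expectation (\<lambda>\<omega>. 1)"
        by (intro integral_mono_AE *) (use ae in \<open>auto elim: eventually_mono\<close>)
      then show ?thesis using True by simp
    next
      case False
      have "outcome.expectation (\<lambda>\<omega>. X i \<omega> * X j \<omega>) = outcome.expectation (X i) * outcome.expectation (X j)"
        using that False assms(2)
        by (intro expectation_mult[of "K i" "K j"] meas int) (auto simp: disjoint_family_on_def)
      then show ?thesis using zero that False by simp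
    qed
  qed
  have sq: "(\<Sum>j\<in>L. X j \<omega>)\<^sup>2 = (\<Sum>i\<in>L. \<Sum>j\<in>L. X i \<omega> * X j \<omega>)" for \<omega>
    by (simp add: power2_eq_square sum_product)
  have intsq: "integrable \<Omega> (\<lambda>\<omega>. (\<Sum>j\<in>L. X j \<omega>)\<^sup>2)"
    unfolding sq by (intro Bochner_Integration.integrable_sum prod)
  have "outcome.expectation (\<lambda>\<omega>. (\<Sum>j\<in>L. X j \<omega>)\<^sup>2) = (\<Sum>i\<in>L. \<Sum>j\<in>L. outcome.expectation (\<lambda>\<omega>. X i \<omega> * X j \<omega>))"
    unfolding sq by (subst Bochner_Integration.integral_sum, intro Bochner_Integration.integrable_sum prod, assumption+)
      (intro sum.cong refl Bochner_Integration.integral_sum prod)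
  also have "\<dots> \<le> (\<Sum>i\<in>L. \<Sum>j\<in>L. of_bool (i = j))"
    by (intro sum_mono prod)
  also have "\<dots> = n"
    using assms(1) by (simp add: n_def of_bool_def sum.delta)
  finally have second: "outcome.expectation (\<lambda>\<omega>. (\<Sum>j\<in>L. X j \<omega>)\<^sup>2) \<le> n" .
  have young: "\<bar>x\<bar> \<le> x\<^sup>2 / (2 * sqrt n) + sqrt n / 2" for x
  proof -
    have "0 \<le> (\<bar>x\<bar> - sqrt n)\<^sup>2" by simp
    also have "\<dots> = x\<^sup>2 - 2 * \<bar>x\<bar> * sqrt n + n" using n by (simp add: power2_diff)
    finally have "2 * \<bar>x\<bar> * sqrt n \<le> x\<^sup>2 + sqrt n * sqrt n" using n by simp
    then have "\<bar>x\<bar> \<le> (x\<^sup>2 + sqrt n * sqrt n) / (2 * sqrt n)" using n by (simp add: field_simps)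
    also have "\<dots> = x\<^sup>2 / (2 * sqrt n) + sqrt n / 2" using n by (simp add: add_divide_distrib del: real_sqrt_mult_self)
    finally show ?thesis .
  qed
  have "outcome.expectation (\<lambda>\<omega>. \<bar>\<Sum>j\<in>L. X j \<omega>\<bar>)
      \<le> outcome.expectation (\<lambda>\<omega>. (\<Sum>j\<in>L. X j \<omega>)\<^sup>2 / (2 * sqrt n) + sqrt n / 2)"
    by (intro integral_mono young integrable_abs Bochner_Integration.integrable_sum int
        Bochner_Integration.integrable_add integrable_divide intsq) auto
  also have "\<dots> = outcome.expectation (\<lambda>\<omega>. (\<Sum>j\<in>L. X j \<omega>)\<^sup>2) / (2 * sqrt n) + sqrt n / 2"
    using intsq by simp
  also have "\<dots> \<le> n / (2 * sqrt n) + sqrt n / 2"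
    using second n by (intro add_right_mono divide_right_mono) auto
  also have "\<dots> = sqrt n"
  proof -
    have "n / sqrt n = sqrt n" using n by (intro real_div_sqrt) simp
    then have "n / (2 * sqrt n) = sqrt n / 2" by (metis divide_divide_eq_left mult.commute)
    then show ?thesis by simp
  qed
  finally show ?thesis by (simp add: n_def)
qed simp

lemma AE_coordinate:
  assumes "AE y in source_law \<mu> x. P y"
  shows "AE \<omega> in \<Omega>. P (\<omega> x)"
  unfolding outcome_space_def
  by (rule AE_PiM_component) (use assms in \<open>auto simp: prob_space_source_law\<close>)

lemma countable_source: "countable (UNIV :: source set)"
proof -
  have "(UNIV :: source set) = range Ability \<union> range (\<lambda>(t, i, j). Simulated t i j) \<union> range Auxiliary"
    by (auto simp: image_iff) (metis source.exhaust)
  then show ?thesis by (metis countable_Un countable_image countableI_type)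
qed

lemma AE_unit_interval: "AE \<omega> in \<Omega>. \<forall>x. 0 \<le> \<omega> x \<and> \<omega> x \<le> 1"
proof -
  have "AE y in source_law \<mu> x. 0 \<le> y \<and> y \<le> 1" for x
  proof (cases "\<exists>t. x = Auxiliary t")
    case True
    then obtain t where x: "x = Auxiliary t" by blast
    have "AE y in uniform_measure lborel {0..1::real}. 0 \<le> y \<and> y \<le> 1"
      by (rule AE_uniform_measureI) auto
    then show ?thesis by (simp only: x source_law.simps)
  next
    case False
    have "AE y in \<mu>. y \<in> {0..1}" using support by (subst AE_in_set_eq_1) auto
    moreover have "source_law \<mu> x = \<mu>" using False by (cases x) auto
    ultimately show ?thesis by (simp only:) simp
  qed
  then have "AE \<omega> in \<Omega>. \<forall>x\<in>UNIV. 0 \<le> \<omega> x \<and> \<omega> x \<le> 1"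
    by (intro AE_ball_countable[THEN iffD2] countable_source ballI AE_coordinate)
  then show ?thesis by simp
qed

lemma prob_coordinate:
  assumes "A \<in> sets borel"
  shows "outcome.prob {\<omega>. \<omega> x \<in> A} = measure (source_law \<mu> x) A"
proof -
  have "distr \<Omega> (source_law \<mu> x) (\<lambda>\<omega>. \<omega> x) = source_law \<mu> x"
    unfolding outcome_space_def by (rule distr_PiM_component) (auto simp: prob_space_source_law)
  then have "measure (source_law \<mu> x) A = measure (distr \<Omega> (source_law \<mu> x) (\<lambda>\<omega>. \<omega> x)) A" by simp
  also have "\<dots> = outcome.prob ((\<lambda>\<omega>. \<omega> x) -` A \<inter> space \<Omega>)"
    using assms by (intro measure_distr) (auto cong: measurable_cong_sets)
  also have "(\<lambda>\<omega>. \<omega> x) -` A \<inter> space \<Omega> = {\<omega>. \<omega> x \<in> A}" by auto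
  finally show ?thesis by simp
qed

end

section \<open>Quantiles and uniform ranks\<close>

context ability_law
begin

lemma event_Collect:
  assumes "Measurable.pred \<Omega> P"
  shows "Collect P \<in> outcome.events"
  using assms by (simp add: pred_def)

abbreviation lower_cdf :: "real \<Rightarrow> real" where "lower_cdf \<theta> \<equiv> measure \<mu> {..<\<theta>}"

lemma cdf_ge_1:
  assumes "1 \<le> x"
  shows "cdf \<mu> x = 1"
proof -
  have "measure \<mu> {0..1} \<le> cdf \<mu> x"
    unfolding cdf_def using assms by (intro finite_measure_mono) auto
  then show ?thesis using support cdf_bounded_prob[of x] by simp
qed

lemma cdf_neg:
  assumes "x < 0"
  shows "cdf \<mu> x = 0"
proof -
  have "measure \<mu> ({..x} \<union> {0..1}) = cdf \<mu> x + measure \<mu> {0..1}"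
    unfolding cdf_def using assms by (intro finite_measure_Union) auto
  then show ?thesis using support prob_le_1[of "{..x} \<union> {0..1}"] cdf_nonneg[of x] by simp
qed

lemma cdf_eq_lower_cdf_plus: "cdf \<mu> \<theta> = lower_cdf \<theta> + measure \<mu> {\<theta>}"
proof -
  have "measure \<mu> ({..<\<theta>} \<union> {\<theta>}) = lower_cdf \<theta> + measure \<mu> {\<theta>}"
    by (intro finite_measure_Union) auto
  moreover have "{..<\<theta>} \<union> {\<theta>} = {..\<theta>}" by auto
  ultimately show ?thesis by (simp add: cdf_def)
qed

lemma cdf_le_lower_cdf:
  assumes "v < \<theta>"
  shows "cdf \<mu> v \<le> lower_cdf \<theta>"
  unfolding cdf_def using assms by (intro finite_measure_mono) auto

lemma lower_cdf_le:
  assumes "\<And>v. v < \<theta> \<Longrightarrow> cdf \<mu> v \<le> q"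
  shows "lower_cdf \<theta> \<le> q"
  by (rule tendsto_upperbound[OF cdf_at_left])
    (use assms in \<open>auto simp: eventually_at_left_field intro!: exI[of _ "\<theta> - 1"]\<close>)

text \<open>The Galois connection between the quantile function and the distribution function; right continuity makes the
infimum in the definition of the quantile attained.\<close>
lemma quantile_le_iff:
  assumes "q \<le> 1" "0 \<le> v" "v \<le> 1"
  shows "quantile \<mu> q \<le> v \<longleftrightarrow> q \<le> cdf \<mu> v"
proof
  let ?S = "{v. 0 \<le> v \<and> v \<le> 1 \<and> q \<le> cdf \<mu> v}"
  have bdd: "bdd_below ?S" by (auto intro!: bdd_belowI[of _ 0])
  have ne: "?S \<noteq> {}" using assms(1) by (auto intro!: exI[of _ 1] simp: cdf_ge_1)
  show "q \<le> cdf \<mu> v \<Longrightarrow> quantile \<mu> q \<le> v"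
    unfolding quantile_def using assms by (intro cInf_lower bdd) auto
  have "q \<le> (INF s\<in>?S. cdf \<mu> s)" by (rule cINF_greatest[OF ne]) auto
  also have "\<dots> = cdf \<mu> (quantile \<mu> q)"
    unfolding quantile_def
    by (intro continuous_at_Inf_mono[OF _ _ ne bdd, symmetric] monoI cdf_nondecreasing cdf_is_right_cont)
  finally have "q \<le> cdf \<mu> (quantile \<mu> q)" .
  then show "quantile \<mu> q \<le> v \<Longrightarrow> q \<le> cdf \<mu> v"
    using cdf_nondecreasing order_trans by blast
qed

lemma quantile_nonneg:
  assumes "q \<le> 1"
  shows "0 \<le> quantile \<mu> q"
  unfolding quantile_def using assms
  by (intro cInf_greatest) (auto intro!: exI[of _ 1] simp: cdf_ge_1)

lemma quantile_le_1: "q \<le> 1 \<Longrightarrow> quantile \<mu> q \<le> 1"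
  by (simp add: quantile_le_iff cdf_ge_1)

lemma quantile_mono:
  assumes "q \<le> q'" "q' \<le> 1"
  shows "quantile \<mu> q \<le> quantile \<mu> q'"
proof -
  have "q' \<le> cdf \<mu> (quantile \<mu> q')"
    using assms quantile_le_iff[of q' "quantile \<mu> q'"] quantile_nonneg quantile_le_1 by auto
  then show ?thesis
    using assms by (subst quantile_le_iff) (auto simp: quantile_nonneg quantile_le_1)
qed

lemma quantile_eq_0:
  assumes "q \<le> 0"
  shows "quantile \<mu> q = 0"
  using assms quantile_le_iff[of q 0] cdf_nonneg[of 0] quantile_nonneg[of q] by auto

text \<open>The quantile draw, written without suprema and infima of the fibre of the quantile function: the fibre of
\<open>\<theta>\<close> spans the jump of the distribution function at \<open>\<theta>\<close>. This form is measurable by inspection, and it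
agrees with the quantile draw outside a null set.\<close>
definition rank :: "nat \<Rightarrow> outcome \<Rightarrow> real" where
  "rank t \<omega> = lower_cdf (\<omega> (Ability t)) + \<omega> (Auxiliary t) * measure \<mu> {\<omega> (Ability t)}"

lemma lower_cdf_measurable [measurable]: "lower_cdf \<in> borel_measurable borel"
  by (intro borel_measurable_mono monoI finite_measure_mono) auto

lemma cdf_measurable [measurable]: "cdf \<mu> \<in> borel_measurable borel"
  by (intro borel_measurable_mono monoI cdf_nondecreasing)

lemma rank_measurable:
  assumes "Ability t \<in> I" "Auxiliary t \<in> I"
  shows "rank t \<in> borel_measurable (coords I)"
proof -
  note [measurable] = assms[THEN measurable_coordinate]
  have "rank t = (\<lambda>\<omega>. lower_cdf (\<omega> (Ability t))
      + \<omega> (Auxiliary t) * (cdf \<mu> (\<omega> (Ability t)) - lower_cdf (\<omega> (Ability t))))"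
    by (simp add: rank_def cdf_eq_lower_cdf_plus fun_eq_iff)
  then show ?thesis by simp
qed

lemma rank_measurable_\<Omega> [measurable]: "rank t \<in> borel_measurable \<Omega>"
  by (rule measurable_coords_\<Omega>[OF rank_measurable[of t UNIV]]) auto

lemma rank_between:
  assumes "0 \<le> \<omega> (Auxiliary t)" "\<omega> (Auxiliary t) \<le> 1"
  shows "lower_cdf (\<omega> (Ability t)) \<le> rank t \<omega>" "rank t \<omega> \<le> cdf \<mu> (\<omega> (Ability t))"
  using assms mult_right_mono[of "\<omega> (Auxiliary t)" 1 "measure \<mu> {\<omega> (Ability t)}"]
  by (auto simp: rank_def cdf_eq_lower_cdf_plus)

lemma lower_cdf_quantile_le:
  assumes "0 \<le> x" "x \<le> 1"
  shows "lower_cdf (quantile \<mu> x) \<le> x"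
proof (rule lower_cdf_le)
  fix v assume v: "v < quantile \<mu> x"
  show "cdf \<mu> v \<le> x"
  proof (cases "v < 0")
    case True
    then show ?thesis using assms by (simp add: cdf_neg)
  next
    case False
    then have "\<not> quantile \<mu> x \<le> v" "v \<le> 1" using v quantile_le_1[OF assms(2)] by auto
    then show ?thesis using False assms by (simp add: quantile_le_iff)
  qed
qed

lemma le_cdf_quantile:
  assumes "x \<le> 1"
  shows "x \<le> cdf \<mu> (quantile \<mu> x)"
  using assms quantile_le_iff[of x "quantile \<mu> x"] by (simp add: quantile_nonneg quantile_le_1)

lemma prob_ability_eq_and:
  assumes "A \<in> sets borel"
  shows "outcome.prob {\<omega>. \<omega> (Ability t) = v \<and> \<omega> (Auxiliary t) \<in> A}
    = measure \<mu> {v} * measure lborel ({0..1} \<inter> A)"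
proof -
  let ?X = "\<lambda>\<omega>. indicator {v} (\<omega> (Ability t)) :: real" and ?Y = "\<lambda>\<omega>. indicator A (\<omega> (Auxiliary t)) :: real"
  have [measurable]: "(\<lambda>\<omega>. \<omega> (Ability t)) \<in> borel_measurable (coords {Ability t})"
    "(\<lambda>\<omega>. \<omega> (Auxiliary t)) \<in> borel_measurable (coords {Auxiliary t})"
    by (auto intro: measurable_coordinate)
  note [measurable] = assms
  have "outcome.expectation (\<lambda>\<omega>. ?X \<omega> * ?Y \<omega>) = outcome.expectation ?X * outcome.expectation ?Y"
    by (intro expectation_mult[of "{Ability t}" "{Auxiliary t}"] integrable_bounded[where c = 1])
      (auto simp: indicator_def)
  moreover have "(\<lambda>\<omega>. ?X \<omega> * ?Y \<omega>) = indicator {\<omega>. \<omega> (Ability t) = v \<and> \<omega> (Auxiliary t) \<in> A}"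
    "?X = indicator {\<omega>. \<omega> (Ability t) \<in> {v}}" "?Y = indicator {\<omega>. \<omega> (Auxiliary t) \<in> A}"
    by (auto simp: indicator_def fun_eq_iff)
  moreover have "outcome.prob {\<omega>. \<omega> (Auxiliary t) \<in> A} = measure lborel ({0..1} \<inter> A)"
    using assms by (simp add: prob_coordinate measure_uniform_measure)
  moreover have "outcome.prob {\<omega>. \<omega> (Ability t) \<in> {v}} = measure \<mu> {v}"
    by (subst prob_coordinate) auto
  moreover have "{\<omega>. \<omega> (Ability t) \<in> {v}} \<in> outcome.events"
    "{\<omega>. \<omega> (Auxiliary t) \<in> A} \<in> outcome.events"
    "{\<omega>. \<omega> (Ability t) = v \<and> \<omega> (Auxiliary t) \<in> A} \<in> outcome.events"
    by (rule event_Collect, measurable)+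
  ultimately show ?thesis by simp
qed

lemma prob_ability_less: "outcome.prob {\<omega>. \<omega> (Ability t) < v} = lower_cdf v"
  using prob_coordinate[of "{..<v}" "Ability t"] by simp

text \<open>With \<open>v\<close> the quantile of \<open>x\<close>, a rank below \<open>x\<close> forces the ability to be below \<open>v\<close>, or to be
equal to \<open>v\<close> with the auxiliary variable below \<open>c\<close>, the fraction of the jump at \<open>v\<close> that lies below
\<open>x\<close>.\<close>
lemma prob_rank_less_le:
  assumes "0 < x" "x \<le> 1"
  shows "outcome.prob {\<omega>. rank t \<omega> < x} \<le> x"
proof -
  define v where "v = quantile \<mu> x"
  define J where "J = measure \<mu> {v}"
  define c where "c = (x - lower_cdf v) / J"
  have G: "lower_cdf v \<le> x" "x \<le> lower_cdf v + J"
    using assms lower_cdf_quantile_le[of x] le_cdf_quantile[of x] cdf_eq_lower_cdf_plus[of v]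
    by (auto simp: v_def J_def)
  have J: "J \<ge> 0" by (simp add: J_def)
  let ?A = "{\<omega>. \<omega> (Ability t) < v}" and ?B = "{\<omega>. \<omega> (Ability t) = v \<and> \<omega> (Auxiliary t) \<in> {0..<c}}"
  have events: "?A \<in> outcome.events" "?B \<in> outcome.events"
    by (rule event_Collect, measurable)+
  have "outcome.prob {\<omega>. rank t \<omega> < x}
      \<le> outcome.prob (?A \<union> ?B)"
  proof (rule outcome.finite_measure_mono_AE)
    show "AE \<omega> in \<Omega>. \<omega> \<in> {\<omega>. rank t \<omega> < x} \<longrightarrow> \<omega> \<in> ?A \<union> ?B"
      using AE_unit_interval
    proof eventually_elim
      case (elim \<omega>)
      note b = rank_between[of \<omega> t] 
      show ?case
      proof safe
        assume less: "rank t \<omega> < x" and nB: "\<not> (\<omega> (Ability t) < v)"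
        have "\<omega> (Ability t) \<le> v"
        proof (rule ccontr)
          assume "\<not> \<omega> (Ability t) \<le> v"
          then have "cdf \<mu> v \<le> lower_cdf (\<omega> (Ability t))" by (intro cdf_le_lower_cdf) auto
          then show False using less b elim le_cdf_quantile[of x] assms by (auto simp: v_def)
        qed
        with nB show v: "\<omega> (Ability t) = v" by simp
        have *: "lower_cdf v + \<omega> (Auxiliary t) * J < x" using less v by (simp add: rank_def J_def)
        have "J \<noteq> 0" using * G by auto
        then show "\<omega> (Auxiliary t) \<in> {0..<c}"
          using * J elim by (auto simp: c_def field_simps)
      qed
    qed
  qed (intro sets.Un events)
  also have "\<dots> \<le> outcome.prob ?A + outcome.prob ?B"
    by (rule measure_Un_le) (rule events)+
  also have "outcome.prob ?A = lower_cdf v" by (rule prob_ability_less)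
  also have "outcome.prob ?B = J * measure lborel ({0..1} \<inter> {0..<c})"
    unfolding J_def by (rule prob_ability_eq_and) simp
  also have "lower_cdf v + J * measure lborel ({0..1} \<inter> {0..<c}) \<le> x"
  proof (cases "J = 0")
    case False
    have c: "0 \<le> c" "c \<le> 1" using G J False by (auto simp: c_def field_simps)
    then have "{0..1} \<inter> {0..<c} = {0..<c}" by auto
    then show ?thesis using c False by (simp add: c_def)
  qed (use G in simp)
  finally show ?thesis .
qed

text \<open>The converse of the preceding estimate, with the same decomposition. Together the two one-sided bounds show that
ranks are uniform, without any discussion of whether ranks equal to \<open>x\<close> have positive probability.\<close>
lemma le_prob_rank_le:
  assumes "0 < x" "x < 1"
  shows "x \<le> outcome.prob {\<omega>. rank t \<omega> \<le> x}"
proof -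
  define v where "v = quantile \<mu> x"
  define J where "J = measure \<mu> {v}"
  define c where "c = (x - lower_cdf v) / J"
  have G: "lower_cdf v \<le> x" "x \<le> lower_cdf v + J"
    using assms lower_cdf_quantile_le[of x] le_cdf_quantile[of x] cdf_eq_lower_cdf_plus[of v]
    by (auto simp: v_def J_def)
  have J: "J \<ge> 0" by (simp add: J_def)
  let ?A = "{\<omega>. \<omega> (Ability t) < v}" and ?B = "{\<omega>. \<omega> (Ability t) = v \<and> \<omega> (Auxiliary t) \<in> {0..c}}"
  have "x \<le> lower_cdf v + J * measure lborel ({0..1} \<inter> {0..c})"
  proof (cases "J = 0")
    case False
    have c: "0 \<le> c" "c \<le> 1" using G J False by (auto simp: c_def field_simps)
    then have "{0..1} \<inter> {0..c} = {0..c}" by auto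
    then show ?thesis using c False by (simp add: c_def)
  qed (use G in simp)
  also have "\<dots> = outcome.prob ?A + outcome.prob ?B"
    unfolding prob_ability_less J_def by (subst prob_ability_eq_and) simp_all
  also have "\<dots> = outcome.prob (?A \<union> ?B)"
    by (rule outcome.finite_measure_Union[symmetric], (rule event_Collect, measurable)+) auto
  also have "\<dots> \<le> outcome.prob {\<omega>. rank t \<omega> \<le> x}"
  proof (rule outcome.finite_measure_mono_AE)
    show "AE \<omega> in \<Omega>. \<omega> \<in> ?A \<union> ?B \<longrightarrow> \<omega> \<in> {\<omega>. rank t \<omega> \<le> x}"
      using AE_unit_interval
    proof eventually_elim
      case (elim \<omega>)
      note b = rank_between[of \<omega> t]
      show ?case
      proof safe
        assume "\<omega> (Ability t) < v"
        then have "cdf \<mu> (\<omega> (Ability t)) \<le> lower_cdf v" by (rule cdf_le_lower_cdf)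
        then show "rank t \<omega> \<le> x" using b elim G by auto
      next
        assume v: "v = \<omega> (Ability t)" and u: "\<omega> (Auxiliary t) \<in> {0..c}"
        show "rank t \<omega> \<le> x"
        proof (cases "J = 0")
          case True
          then show ?thesis using G v by (simp add: rank_def J_def)
        next
          case False
          then have "\<omega> (Auxiliary t) * J \<le> x - lower_cdf v"
            using u J by (auto simp: c_def field_simps)
          then show ?thesis using v by (simp add: rank_def J_def)
        qed
      qed
    qed
  qed (rule event_Collect, measurable)
  finally show ?thesis .
qed

abbreviation clamp :: "real \<Rightarrow> real" where "clamp x \<equiv> max 0 (min 1 x)"

lemma
  shows prob_rank_le: "outcome.prob {\<omega>. rank t \<omega> \<le> x} = clamp x"
    and prob_rank_less: "outcome.prob {\<omega>. rank t \<omega> < x} = clamp x"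
proof -
  have mono: "outcome.prob {\<omega>. rank t \<omega> \<le> y} \<le> outcome.prob {\<omega>. rank t \<omega> < x}" if "y < x" for x y
    using that by (intro outcome.finite_measure_mono event_Collect) auto
  have mono': "outcome.prob {\<omega>. rank t \<omega> < x} \<le> outcome.prob {\<omega>. rank t \<omega> \<le> x}" for x
    by (intro outcome.finite_measure_mono event_Collect) auto
  have up: "outcome.prob {\<omega>. rank t \<omega> \<le> x} \<le> clamp x"
  proof (cases "x < 1")
    case True
    have "outcome.prob {\<omega>. rank t \<omega> \<le> x} \<le> y" if "clamp x < y" "y < 1" for y
      using mono[of x y] prob_rank_less_le[of y t] that by linarith
    then show ?thesis using True by (intro dense_ge_bounded[of "clamp x" 1]) auto
  qed simp
  have low: "clamp x \<le> outcome.prob {\<omega>. rank t \<omega> < x}"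
  proof (cases "0 < x")
    case True
    have "y \<le> outcome.prob {\<omega>. rank t \<omega> < x}" if "0 < y" "y < clamp x" for y
      using mono[of y x] le_prob_rank_le[of y t] that by linarith
    then show ?thesis using True by (intro dense_le_bounded[of 0 "clamp x"]) auto
  qed simp
  show "outcome.prob {\<omega>. rank t \<omega> \<le> x} = clamp x" "outcome.prob {\<omega>. rank t \<omega> < x} = clamp x"
    using up low mono'[of x] by linarith+
qed

lemma prob_rank_greater: "outcome.prob {\<omega>. rank t \<omega> > x} = 1 - clamp x"
proof -
  have "{\<omega>. rank t \<omega> > x} = space \<Omega> - {\<omega>. rank t \<omega> \<le> x}" by auto
  moreover have "{\<omega>. rank t \<omega> \<le> x} \<in> outcome.events" by (rule event_Collect) measurable
  ultimately show ?thesis by (simp only: outcome.prob_compl prob_rank_le)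
qed

lemma prob_rank_ge: "outcome.prob {\<omega>. rank t \<omega> \<ge> x} = 1 - clamp x"
proof -
  have "{\<omega>. rank t \<omega> \<ge> x} = space \<Omega> - {\<omega>. rank t \<omega> < x}" by auto
  moreover have "{\<omega>. rank t \<omega> < x} \<in> outcome.events" by (rule event_Collect) measurable
  ultimately show ?thesis by (simp only: outcome.prob_compl prob_rank_less)
qed

lemma prob_rank_between_le:
  assumes "x \<le> y"
  shows "outcome.prob {\<omega>. x \<le> rank t \<omega> \<and> rank t \<omega> \<le> y} \<le> y - x"
proof -
  have "{\<omega>. x \<le> rank t \<omega> \<and> rank t \<omega> \<le> y} = {\<omega>. rank t \<omega> \<le> y} - {\<omega>. rank t \<omega> < x}" by auto
  moreover have "outcome.prob ({\<omega>. rank t \<omega> \<le> y} - {\<omega>. rank t \<omega> < x}) = clamp y - clamp x"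
    using assms by (subst outcome.finite_measure_Diff)
      (auto simp: prob_rank_le prob_rank_less intro!: event_Collect)
  ultimately show ?thesis using assms by simp
qed

text \<open>Abilities to the left of which the distribution function is locally constant are not attained by the quantile
transform of a uniform variable; a rational point in the flat piece reduces the claim to countably many null sets.\<close>
lemma AE_cdf_strict: "AE \<theta> in \<mu>. \<forall>v<\<theta>. cdf \<mu> v < cdf \<mu> \<theta>"
proof -
  interpret c: cdf_distribution \<mu> by (simp add: cdf_distribution_def real_distribution)
  have null: "AE \<theta> in \<mu>. r < \<theta> \<longrightarrow> cdf \<mu> r < cdf \<mu> \<theta>" for r
  proof -
    let ?U = "restrict_space lborel {0<..<1::real}"
    have "AE q in ?U. r < c.I q \<longrightarrow> cdf \<mu> r < cdf \<mu> (c.I q)"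
    proof (rule AE_I2, safe)
      fix q assume q: "q \<in> space ?U" and "r < c.I q"
      then have "\<not> q \<le> cdf \<mu> r" and "q \<le> cdf \<mu> (c.I q)"
        using c.pseudoinverse[of q r] c.pseudoinverse[of q "c.I q"] by (auto simp: space_restrict_space)
      then show "cdf \<mu> r < cdf \<mu> (c.I q)" by linarith
    qed
    then have "AE \<theta> in distr ?U borel c.I. r < \<theta> \<longrightarrow> cdf \<mu> r < cdf \<mu> \<theta>"
      by (subst AE_distr_iff) auto
    then show ?thesis unfolding c.distr_I_eq_M .
  qed
  have "AE \<theta> in \<mu>. \<forall>r\<in>\<rat>. r < \<theta> \<longrightarrow> cdf \<mu> r < cdf \<mu> \<theta>"
    using null by (subst AE_ball_countable) (auto intro: countable_rat)
  then show ?thesis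
  proof eventually_elim
    case (elim \<theta>)
    show ?case
    proof (intro allI impI)
      fix v assume "v < \<theta>"
      then obtain r where "r \<in> \<rat>" "v < r" "r < \<theta>" using Rats_dense_in_real by blast
      then show "cdf \<mu> v < cdf \<mu> \<theta>" using elim cdf_nondecreasing[of v r] by fastforce
    qed
  qed
qed

lemma quantile_eqI:
  assumes "0 \<le> \<theta>" "\<theta> \<le> 1" "q \<le> cdf \<mu> \<theta>" "\<And>v. v < \<theta> \<Longrightarrow> cdf \<mu> v < q"
  shows "quantile \<mu> q = \<theta>"
proof -
  have q: "q \<le> 1" using assms(3) cdf_bounded_prob[of \<theta>] by linarith
  then have "quantile \<mu> q \<le> \<theta>" using assms by (simp add: quantile_le_iff)
  moreover have "\<not> quantile \<mu> q < \<theta>"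
    using assms(4)[of "quantile \<mu> q"] le_cdf_quantile[OF q] by linarith
  ultimately show ?thesis by simp
qed

lemma quantile_draw_eq:
  assumes "0 \<le> \<theta>" "\<theta> \<le> 1" "\<And>v. v < \<theta> \<Longrightarrow> cdf \<mu> v < cdf \<mu> \<theta>"
  shows "quantile_draw \<mu> \<theta> u = lower_cdf \<theta> + u * measure \<mu> {\<theta>}"
proof -
  define S where "S = {q. 0 \<le> q \<and> q \<le> 1 \<and> quantile \<mu> q = \<theta>}"
  have top: "cdf \<mu> \<theta> \<in> S"
    using assms quantile_eqI[of \<theta> "cdf \<mu> \<theta>"] by (auto simp: S_def cdf_nonneg cdf_bounded_prob)
  have inner: "q \<in> S" if "lower_cdf \<theta> < q" "q \<le> cdf \<mu> \<theta>" for q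
  proof -
    have "cdf \<mu> v < q" if "v < \<theta>" for v
      using cdf_le_lower_cdf[OF that] \<open>lower_cdf \<theta> < q\<close> by linarith
    then show ?thesis
      using that assms quantile_eqI[of \<theta> q] cdf_bounded_prob[of \<theta>] measure_nonneg[of \<mu> "{..<\<theta>}"]
      by (auto simp: S_def simp del: measure_nonneg)
  qed
  have outer: "lower_cdf \<theta> \<le> q" "q \<le> cdf \<mu> \<theta>" if "q \<in> S" for q
    using that lower_cdf_quantile_le[of q] le_cdf_quantile[of q] by (auto simp: S_def)
  have "Sup S = cdf \<mu> \<theta>" by (rule cSup_eq_maximum) (use top outer in auto)
  moreover have "Inf S = lower_cdf \<theta>"
  proof (rule cInf_eq_non_empty)
    fix y assume y: "\<And>q. q \<in> S \<Longrightarrow> y \<le> q"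
    show "y \<le> lower_cdf \<theta>"
    proof (cases "lower_cdf \<theta> < cdf \<mu> \<theta>")
      case True
      then show ?thesis by (rule dense_ge_bounded) (use inner y in auto)
    next
      case False
      then show ?thesis using y[OF top] by simp
    qed
  qed (use top outer in auto)
  ultimately show ?thesis
    unfolding quantile_draw_def S_def[symmetric] by (simp add: Let_def cdf_eq_lower_cdf_plus)
qed

text \<open>The pathwise inequalities hold for these outcomes, which have probability one.\<close>
definition regular :: "outcome \<Rightarrow> bool" where
  "regular \<omega> \<longleftrightarrow> (\<forall>x. 0 \<le> \<omega> x \<and> \<omega> x \<le> 1) \<and>
    (\<forall>t. 0 < rank t \<omega> \<and> rank t \<omega> \<le> 1 \<and> quantile \<mu> (rank t \<omega>) = \<omega> (Ability t) \<and>
      quantile_draw \<mu> (\<omega> (Ability t)) (\<omega> (Auxiliary t)) = rank t \<omega>)"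

lemma AE_regular: "AE \<omega> in \<Omega>. regular \<omega>"
proof -
  have "AE \<omega> in \<Omega>. \<forall>v<\<omega> (Ability t). cdf \<mu> v < cdf \<mu> (\<omega> (Ability t))" for t
    using AE_cdf_strict by (intro AE_coordinate) (simp only: source_law.simps)
  then have strict: "AE \<omega> in \<Omega>. \<forall>t. \<forall>v<\<omega> (Ability t). cdf \<mu> v < cdf \<mu> (\<omega> (Ability t))"
    by (simp add: AE_all_countable)
  have "AE \<omega> in \<Omega>. rank t \<omega> > 0" for t
  proof -
    have "{\<omega>. rank t \<omega> > 0} \<in> outcome.events" by (rule event_Collect) measurable
    from outcome.AE_in_set_eq_1[OF this] show ?thesis using prob_rank_greater[of 0 t] by simp
  qed
  then have pos: "AE \<omega> in \<Omega>. \<forall>t. rank t \<omega> > 0" by (simp add: AE_all_countable)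
  have "AE u in uniform_measure lborel {0..1::real}. u \<noteq> 0"
    using AE_lborel_singleton[of 0] by (intro AE_uniform_measureI) auto
  then have "AE \<omega> in \<Omega>. \<omega> (Auxiliary t) \<noteq> 0" for t
    by (intro AE_coordinate) (simp only: source_law.simps)
  then have aux: "AE \<omega> in \<Omega>. \<forall>t. \<omega> (Auxiliary t) \<noteq> 0" by (simp add: AE_all_countable)
  from AE_unit_interval strict pos aux show ?thesis
  proof eventually_elim
    case (elim \<omega>)
    have "rank t \<omega> \<le> 1 \<and> quantile \<mu> (rank t \<omega>) = \<omega> (Ability t) \<and>
      quantile_draw \<mu> (\<omega> (Ability t)) (\<omega> (Auxiliary t)) = rank t \<omega>" for t
    proof (intro conjI)
      note b = rank_between[of \<omega> t]
      show "rank t \<omega> \<le> 1" using b elim cdf_bounded_prob[of "\<omega> (Ability t)"] by auto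
      show "quantile_draw \<mu> (\<omega> (Ability t)) (\<omega> (Auxiliary t)) = rank t \<omega>"
        unfolding rank_def using elim by (intro quantile_draw_eq) auto
      show "quantile \<mu> (rank t \<omega>) = \<omega> (Ability t)"
      proof (rule quantile_eqI)
        fix v assume v: "v < \<omega> (Ability t)"
        show "cdf \<mu> v < rank t \<omega>"
        proof (cases "measure \<mu> {\<omega> (Ability t)} = 0")
          case True
          then have "rank t \<omega> = cdf \<mu> (\<omega> (Ability t))"
            by (simp add: rank_def cdf_eq_lower_cdf_plus)
          with elim v show ?thesis by simp
        next
          case False
          then have "0 < \<omega> (Auxiliary t) * measure \<mu> {\<omega> (Ability t)}"
            using elim by (intro mult_pos_pos) (auto simp: less_le zero_less_measure_iff)
          then show ?thesis using cdf_le_lower_cdf[OF v] by (simp add: rank_def)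
        qed
      qed (use b elim in auto)
    qed
    then show ?case using elim by (simp add: regular_def)
  qed
qed

lemma regularD:
  assumes "regular \<omega>"
  shows "0 \<le> \<omega> x" "\<omega> x \<le> 1" "0 < rank t \<omega>" "rank t \<omega> \<le> 1" "quantile \<mu> (rank t \<omega>) = \<omega> (Ability t)"
    "quantile_draw \<mu> (\<omega> (Ability t)) (\<omega> (Auxiliary t)) = rank t \<omega>"
  using assms by (auto simp: regular_def)

end

section \<open>Thresholds at gaps\<close>

context ability_law
begin

text \<open>Here \<open>u\<close> is the rank of the candidate, \<open>U\<close> the rank of the ability that sets the value of the last unit of
budget, and \<open>p\<close> the typical position of \<open>U\<close>. The threshold \<open>r\<close> is the gap nearest to \<open>p\<close> if it is
within \<open>w\<close>, and \<open>p\<close> otherwise. A loss occurs only if \<open>U\<close> and the threshold lie on opposite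
sides of \<open>u\<close>. If \<open>U\<close> is close to \<open>p\<close>, no gap separates \<open>u\<close> from \<open>U\<close>: in the first case any
other gap is at least \<open>\<epsilon>0 / 2\<close> away from \<open>p\<close>, in the second every gap is more than \<open>w\<close> away.\<close>
lemma cluster_threshold:
  assumes "clustered C0 \<beta> \<epsilon>0 \<delta> \<mu>" "0 \<le> \<beta>" "0 < \<epsilon>0" "0 \<le> \<delta>" "0 \<le> w"
  obtains r where "\<And>u U. 0 < u \<Longrightarrow> u \<le> 1 \<Longrightarrow> 0 < U \<Longrightarrow> U \<le> 1 \<Longrightarrow>
    (if r < u then max 0 (quantile \<mu> U - quantile \<mu> u) else max 0 (quantile \<mu> u - quantile \<mu> U))
    \<le> (\<bar>C0\<bar> * (2 * w) powr (1 / (\<beta> + 1)) + \<delta>) * of_bool (p - w \<le> u \<and> u \<le> p + w)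
      + of_bool (p + w \<le> U \<or> U \<le> p - w) + of_bool (p + \<epsilon>0 / 2 \<le> U \<or> U \<le> p - \<epsilon>0 / 2)"
proof -
  from assms(1) obtain n and g :: "nat \<Rightarrow> real" where g: "g 0 = 0 \<and> g (n + 1) = 1 \<and> (\<forall>i\<in>{1..n+1}. g (i - 1) < g i) \<and>
       (\<forall>i\<in>{1..n+1}. \<forall>q\<in>{g (i - 1)<..g i}. \<forall>q'\<in>{g (i - 1)<..g i}.
          \<bar>quantile \<mu> q - quantile \<mu> q'\<bar> \<le> C0 * \<bar>q - q'\<bar> powr (1 / (\<beta> + 1)) + \<delta>) \<and>
       (\<forall>i\<in>{1..n+1}. g i - g (i - 1) \<ge> \<epsilon>0)"
    unfolding clustered_def by (elim exE)
  then have g0: "g 0 = 0" and g1: "g (n + 1) = 1" by simp_all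
  note holder = g[THEN conjunct2, THEN conjunct2, THEN conjunct2, THEN conjunct1, rule_format]
  note gap = g[THEN conjunct2, THEN conjunct2, THEN conjunct2, THEN conjunct2, rule_format]
  define H where "H = \<bar>C0\<bar> * (2 * w) powr (1 / (\<beta> + 1)) + \<delta>"
  have H: "0 \<le> H" using assms by (simp add: H_def)
  have same_cluster: "\<bar>quantile \<mu> x - quantile \<mu> y\<bar> \<le> C0 * \<bar>x - y\<bar> powr (1 / (\<beta> + 1)) + \<delta>"
    if "0 < x" "x < y" "y \<le> 1" "\<And>i. i \<in> {1..n} \<Longrightarrow> \<not> (x \<le> g i \<and> g i < y)" for x y
  proof -
    define i where "i = (LEAST i. y \<le> g i)"
    have top: "y \<le> g (n + 1)" using that(3) g1 by simp
    then have yi: "y \<le> g i" unfolding i_def by (rule LeastI)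
    from top have le: "i \<le> n + 1" unfolding i_def by (rule Least_le)
    have pos: "i \<noteq> 0"
    proof
      assume "i = 0"
      then show False using yi g0 that(1,2) by simp
    qed
    have ngy: "\<not> y \<le> g (i - 1)"
      using pos not_less_Least[of "i - 1" "\<lambda>i. y \<le> g i"] unfolding i_def[symmetric] by simp
    have gx: "g (i - 1) < x"
    proof (cases "i = 1")
      case True
      then show ?thesis using g0 that(1) by simp
    next
      case False
      then have "i - 1 \<in> {1..n}" using le pos by auto
      from that(4)[OF this] ngy show ?thesis by linarith
    qed
    show ?thesis
    proof (rule holder)
      show "i \<in> {1..n+1}" using le pos by simp
      show "x \<in> {g (i - 1)<..g i}" using gx yi that(2) by simp
      show "y \<in> {g (i - 1)<..g i}" using ngy yi by simp
    qed
  qed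
  have sep: "g i + \<epsilon>0 \<le> g j" if "i < j" "j \<le> n + 1" for i j
    using that
  proof (induction j)
    case (Suc j)
    have "g j + \<epsilon>0 \<le> g (Suc j)" using gap[of "Suc j"] Suc.prems by simp
    then show ?case using Suc assms(3) by (cases "i = j") auto
  qed simp
  have sep': "g i + \<epsilon>0 \<le> g j" if "g i < g j" "i \<le> n" "j \<le> n" for i j
    using that sep[of i j] sep[of j i] assms(3) by (cases i j rule: linorder_cases) auto
  obtain r where r: "p - w \<le> r" "r \<le> p + w"
    and right: "\<And>u U i. r < u \<Longrightarrow> U < p + w \<Longrightarrow> U < p + \<epsilon>0 / 2 \<Longrightarrow> i \<in> {1..n} \<Longrightarrow> \<not> (u \<le> g i \<and> g i < U)"
    and left: "\<And>u U i. u \<le> r \<Longrightarrow> p - w < U \<Longrightarrow> p - \<epsilon>0 / 2 < U \<Longrightarrow> i \<in> {1..n} \<Longrightarrow> \<not> (U \<le> g i \<and> g i < u)"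
  proof (cases "\<exists>i\<in>{1..n}. \<bar>g i - p\<bar> \<le> w")
    case True
    then have "{1..n} \<noteq> {}" by auto
    then have k: "arg_min_on (\<lambda>i. \<bar>g i - p\<bar>) {1..n} \<in> {1..n}"
      "\<not> (\<exists>i\<in>{1..n}. \<bar>g i - p\<bar> < \<bar>g (arg_min_on (\<lambda>i. \<bar>g i - p\<bar>) {1..n}) - p\<bar>)"
      by (intro arg_min_if_finite; simp)+
    define k where "k = arg_min_on (\<lambda>i. \<bar>g i - p\<bar>) {1..n}"
    note k = k[folded k_def]
    have min: "\<bar>g k - p\<bar> \<le> \<bar>g i - p\<bar>" if "i \<in> {1..n}" for i
      using k(2) that by (meson not_le)
    from True obtain i where "i \<in> {1..n}" "\<bar>g i - p\<bar> \<le> w" by blast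
    with min[of i] have near: "\<bar>g k - p\<bar> \<le> w" by linarith
    have above: "p + \<epsilon>0 / 2 \<le> g i" if "i \<in> {1..n}" "g k < g i" for i
    proof -
      have "g k + \<epsilon>0 \<le> g i" using that k(1) by (intro sep') auto
      with min[OF that(1)] that(2) assms(3) show ?thesis by arith
    qed
    have below: "g i \<le> p - \<epsilon>0 / 2" if "i \<in> {1..n}" "g i < g k" for i
    proof -
      have "g i + \<epsilon>0 \<le> g k" using that k(1) by (intro sep') auto
      with min[OF that(1)] that(2) assms(3) show ?thesis by arith
    qed
    show ?thesis
    proof (rule that[of "g k"])
      show "p - w \<le> g k" "g k \<le> p + w" using near by arith+
      show "\<not> (u \<le> g i \<and> g i < U)" if "g k < u" "U < p + \<epsilon>0 / 2" "i \<in> {1..n}" for u U i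
        using above[OF that(3)] that by linarith
      show "\<not> (U \<le> g i \<and> g i < u)" if "u \<le> g k" "p - \<epsilon>0 / 2 < U" "i \<in> {1..n}" for u U i
        using below[OF that(3)] that by linarith
    qed
  next
    case False
    then have far: "w < \<bar>g i - p\<bar>" if "i \<in> {1..n}" for i
      using that by (meson not_le)
    show ?thesis
    proof (rule that[of p])
      show "p - w \<le> p" "p \<le> p + w" using assms by auto
      show "\<not> (u \<le> g i \<and> g i < U)" if "p < u" "U < p + w" "i \<in> {1..n}" for u U i
        using far[OF that(3)] that by linarith
      show "\<not> (U \<le> g i \<and> g i < u)" if "u \<le> p" "p - w < U" "i \<in> {1..n}" for u U i
        using far[OF that(3)] that by linarith
    qed
  qed
  have holder_bound: "C0 * d powr (1 / (\<beta> + 1)) + \<delta> \<le> H" if "0 \<le> d" "d \<le> 2 * w" for d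
  proof -
    have "C0 * d powr (1 / (\<beta> + 1)) \<le> \<bar>C0\<bar> * d powr (1 / (\<beta> + 1))"
      by (intro mult_right_mono) auto
    also have "\<dots> \<le> \<bar>C0\<bar> * (2 * w) powr (1 / (\<beta> + 1))"
      using that assms by (intro mult_left_mono powr_mono2) auto
    finally show ?thesis by (simp add: H_def)
  qed
  show thesis
  proof (rule that[of r], fold H_def)
    fix u U :: real assume u: "0 < u" "u \<le> 1" "0 < U" "U \<le> 1"
    \<comment> \<open>As the loss is at most one, the clusters matter only for \<open>U\<close> close to \<open>p\<close>.\<close>
    define near where "near \<longleftrightarrow> p - w \<le> u \<and> u \<le> p + w"
    define far where "far \<longleftrightarrow> p + w \<le> U \<or> U \<le> p - w"
    define beyond where "beyond \<longleftrightarrow> p + \<epsilon>0 / 2 \<le> U \<or> U \<le> p - \<epsilon>0 / 2"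
    define loss where "loss = (if r < u then max 0 (quantile \<mu> U - quantile \<mu> u) else max 0 (quantile \<mu> u - quantile \<mu> U))"
    have "loss \<le> H * of_bool near + of_bool far + of_bool beyond"
    proof (cases "far \<or> beyond")
      case True
      have "loss \<le> 1"
        using quantile_nonneg[of u] quantile_nonneg[of U] quantile_le_1[of u] quantile_le_1[of U] u
        unfolding loss_def by simp
      also have "1 \<le> of_bool far + (of_bool beyond :: real)" using True by (auto simp: of_bool_def)
      finally show ?thesis using H by (simp add: of_bool_def split: if_splits)
    next
      case False
      then have U: "U < p + w" "p - w < U" "U < p + \<epsilon>0 / 2" "p - \<epsilon>0 / 2 < U"
        by (simp_all add: far_def beyond_def)
      have "loss \<le> H * of_bool near"
      proof (cases "r < u")
        case True
        show ?thesis
        proof (cases "u < U")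
          case less: True
          have "\<bar>quantile \<mu> u - quantile \<mu> U\<bar> \<le> C0 * \<bar>u - U\<bar> powr (1 / (\<beta> + 1)) + \<delta>"
            by (rule same_cluster[OF u(1) less u(4)]) (rule right[OF True U(1) U(3)])
          also have "\<dots> \<le> H" using True r U less by (intro holder_bound) linarith+
          finally have "loss \<le> H" using True H unfolding loss_def by simp
          moreover have near using True r U less unfolding near_def by linarith
          ultimately show ?thesis by simp
        next
          case False
          then have "quantile \<mu> U \<le> quantile \<mu> u" using u by (intro quantile_mono) auto
          then have "loss = 0" using True unfolding loss_def by simp
          then show ?thesis using H by simp
        qed
      next
        case False
        show ?thesis
        proof (cases "U < u")
          case less: True
          have ur: "u \<le> r" using False by simp
          have "\<bar>quantile \<mu> U - quantile \<mu> u\<bar> \<le> C0 * \<bar>U - u\<bar> powr (1 / (\<beta> + 1)) + \<delta>"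
            by (rule same_cluster[OF u(3) less u(2)]) (rule left[OF ur U(2) U(4)])
          also have "\<dots> \<le> H" using False r U less by (intro holder_bound) linarith+
          finally have "loss \<le> H" using False H unfolding loss_def by simp
          moreover have near using False r U less unfolding near_def by linarith
          ultimately show ?thesis by simp
        next
          case nless: False
          then have "quantile \<mu> u \<le> quantile \<mu> U" using u by (intro quantile_mono) auto
          then have "loss = 0" using False unfolding loss_def by simp
          then show ?thesis using H by simp
        qed
      qed
      then show ?thesis by simp
    qed
    then show "(if r < u then max 0 (quantile \<mu> U - quantile \<mu> u) else max 0 (quantile \<mu> u - quantile \<mu> U))
      \<le> H * of_bool (p - w \<le> u \<and> u \<le> p + w)
        + of_bool (p + w \<le> U \<or> U \<le> p - w) + of_bool (p + \<epsilon>0 / 2 \<le> U \<or> U \<le> p - \<epsilon>0 / 2)"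
      unfolding loss_def near_def far_def beyond_def .
  qed
qed

section \<open>Concentration of order statistics\<close>

lemma indep_vars_of_bool_rank:
  assumes "A \<in> sets borel"
  shows "outcome.indep_vars (\<lambda>_. borel) (\<lambda>j \<omega>. of_bool (rank j \<omega> \<in> A) :: real) L"
proof (rule indep_vars_coords)
  show "disjoint_family_on (\<lambda>j. {Ability j, Auxiliary j}) L"
    by (auto simp: disjoint_family_on_def)
  fix j
  have [measurable]: "rank j \<in> borel_measurable (coords {Ability j, Auxiliary j})"
    by (rule rank_measurable) auto
  note [measurable] = assms
  show "(\<lambda>\<omega>. of_bool (rank j \<omega> \<in> A) :: real) \<in> borel_measurable (coords {Ability j, Auxiliary j})"
    by measurable
qed

lemma expectation_of_bool:
  assumes "Measurable.pred \<Omega> P"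
  shows "outcome.expectation (\<lambda>\<omega>. of_bool (P \<omega>)) = outcome.prob {\<omega>. P \<omega>}"
proof -
  have "(\<lambda>\<omega>. of_bool (P \<omega>) :: real) = indicator {\<omega>. P \<omega>}" by (auto simp: indicator_def)
  then show ?thesis by simp
qed

lemma count_ranks_deviation:
  fixes a w :: real
  assumes "finite L" "L \<noteq> {}" "A \<in> sets borel" "\<And>j. outcome.prob {\<omega>. rank j \<omega> \<in> A} = a" "0 \<le> w"
  shows "outcome.prob {\<omega>. real (card L) * a + real (card L) * w \<le> (\<Sum>j\<in>L. of_bool (rank j \<omega> \<in> A))} \<le> exp (- 2 * real (card L) * w\<^sup>2)"
    and "outcome.prob {\<omega>. (\<Sum>j\<in>L. of_bool (rank j \<omega> \<in> A)) \<le> real (card L) * a - real (card L) * w} \<le> exp (- 2 * real (card L) * w\<^sup>2)"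
proof -
  note [measurable] = assms(3)
  interpret H: Hoeffding_ineq \<Omega> L "\<lambda>j \<omega>. of_bool (rank j \<omega> \<in> A)" "\<lambda>_. 0" "\<lambda>_. 1" "real (card L) * a"
  proof unfold_locales
    show "outcome.indep_vars (\<lambda>_. borel) (\<lambda>j \<omega>. of_bool (rank j \<omega> \<in> A) :: real) L"
      by (rule indep_vars_of_bool_rank) fact
    have "outcome.expectation (\<lambda>\<omega>. of_bool (rank j \<omega> \<in> A)) = a" for j
      using assms(4) by (subst expectation_of_bool) auto
    then show "real (card L) * a \<equiv> \<Sum>j\<in>L. outcome.expectation (\<lambda>\<omega>. of_bool (rank j \<omega> \<in> A))"
      by simp
  qed (use assms in auto)
  have pos: "0 < (\<Sum>j\<in>L. (1 - 0 :: real)\<^sup>2)" using assms by (simp add: card_gt_0_iff)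
  have n: "real (card L) > 0" using assms by (simp add: card_gt_0_iff)
  have eq: "exp (- 2 * (real (card L) * w)\<^sup>2 / (\<Sum>j\<in>L. (1 - 0 :: real)\<^sup>2)) = exp (- 2 * real (card L) * w\<^sup>2)"
    using n by (simp add: power2_eq_square)
  show "outcome.prob {\<omega>. real (card L) * a + real (card L) * w \<le> (\<Sum>j\<in>L. of_bool (rank j \<omega> \<in> A))} \<le> exp (- 2 * real (card L) * w\<^sup>2)"
    using H.Hoeffding_ineq_ge[of "real (card L) * w", OF _ pos] assms unfolding eq by simp
  show "outcome.prob {\<omega>. (\<Sum>j\<in>L. of_bool (rank j \<omega> \<in> A)) \<le> real (card L) * a - real (card L) * w} \<le> exp (- 2 * real (card L) * w\<^sup>2)"
    using H.Hoeffding_ineq_le[of "real (card L) * w", OF _ pos] assms unfolding eq by simp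
qed

text \<open>The event that the rank of the \<open>b\<close>-th largest of the \<open>T - t\<close> abilities after time \<open>t\<close> deviates by at
least \<open>w\<close> from \<open>1 - b / (T - t)\<close>, stated through counts of ranks.\<close>
definition tail :: "nat \<Rightarrow> nat \<Rightarrow> nat \<Rightarrow> real \<Rightarrow> outcome \<Rightarrow> bool" where
  "tail T t b w \<omega> \<longleftrightarrow>
    real b \<le> (\<Sum>j\<in>{t+1..<T+1}. of_bool (rank j \<omega> \<in> {1 - b / real (T - t) + w..})) \<or>
    (\<Sum>j\<in>{t+1..<T+1}. of_bool (rank j \<omega> \<in> {1 - b / real (T - t) - w<..})) < real b"

lemma tail_measurable [measurable]: "Measurable.pred \<Omega> (tail T t b w)"
  unfolding tail_def by measurable

text \<open>Each deviation means that a count of ranks differs from its mean by at least \<open>(T - t) * w\<close>. If the level that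
defines the count leaves the unit interval, the count is almost surely constant and the event is null.\<close>
lemma prob_tail_le:
  assumes "t < T" "1 \<le> b" "b \<le> T - t" "0 < w"
  shows "outcome.prob {\<omega>. tail T t b w \<omega>} \<le> 2 * exp (- 2 * real (T - t) * w\<^sup>2)"
proof -
  define s where "s = real (T - t)"
  define p where "p = 1 - b / s"
  define L where "L = {t+1..<T+1}"
  have s: "s > 0" "real (card L) = s" using assms by (auto simp: s_def L_def)
  have ps: "s * (1 - p) = b" using s by (simp add: p_def)
  have "real b \<le> s" "0 < real b" using assms by (auto simp: s_def)
  then have p: "0 \<le> p" "p < 1" using s unfolding p_def by (simp_all add: divide_le_eq)
  have L: "finite L" "L \<noteq> {}" using assms by (auto simp: L_def)
  define A where "A \<omega> \<longleftrightarrow> real b \<le> (\<Sum>j\<in>L. of_bool (rank j \<omega> \<in> {p + w..}))" for \<omega>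
  define D where "D \<omega> \<longleftrightarrow> (\<Sum>j\<in>L. of_bool (rank j \<omega> \<in> {p - w<..})) < real b" for \<omega>
  have [measurable]: "Measurable.pred \<Omega> A" "Measurable.pred \<Omega> D"
    unfolding A_def[abs_def] D_def[abs_def] by measurable
  have "{\<omega>. tail T t b w \<omega>} = Collect A \<union> Collect D"
    unfolding tail_def A_def D_def p_def L_def s_def by blast
  then have "outcome.prob {\<omega>. tail T t b w \<omega>} \<le> outcome.prob (Collect A) + outcome.prob (Collect D)"
    by (simp add: measure_Un_le event_Collect)
  moreover have "outcome.prob (Collect A) \<le> exp (- 2 * s * w\<^sup>2)"
  proof (cases "p + w \<le> 1")
    case True
    have "outcome.prob {\<omega>. rank j \<omega> \<in> {p + w..}} = 1 - (p + w)" for j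
      using True p assms prob_rank_ge[of "p + w" j] by simp
    then have "outcome.prob {\<omega>. real (card L) * (1 - (p + w)) + real (card L) * w \<le> (\<Sum>j\<in>L. of_bool (rank j \<omega> \<in> {p + w..}))}
      \<le> exp (- 2 * real (card L) * w\<^sup>2)"
      by (intro count_ranks_deviation(1) L) (use assms in auto)
    moreover have "real (card L) * (1 - (p + w)) + real (card L) * w = b"
      unfolding s(2) ps[symmetric] by (simp add: algebra_simps)
    ultimately show ?thesis by (simp only: A_def[abs_def] s(2))
  next
    case False
    have "AE \<omega> in \<Omega>. \<not> A \<omega>"
      using AE_regular
    proof eventually_elim
      case (elim \<omega>)
      have "rank j \<omega> \<notin> {p + w..}" for j using regularD(4)[OF elim, of j] False by simp
      then show ?case using assms by (simp add: A_def)
    qed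
    from outcome.prob_eq_0_AE[OF this] have "outcome.prob (Collect A) = 0" by simp
    then show ?thesis by (simp only: exp_ge_zero)
  qed
  moreover have "outcome.prob (Collect D) \<le> exp (- 2 * s * w\<^sup>2)"
  proof (cases "0 \<le> p - w")
    case True
    have "outcome.prob {\<omega>. rank j \<omega> \<in> {p - w<..}} = 1 - (p - w)" for j
      using True p assms prob_rank_greater[of "p - w" j] by simp
    then have "outcome.prob {\<omega>. (\<Sum>j\<in>L. of_bool (rank j \<omega> \<in> {p - w<..})) \<le> real (card L) * (1 - (p - w)) - real (card L) * w}
      \<le> exp (- 2 * real (card L) * w\<^sup>2)"
      by (intro count_ranks_deviation(2) L) (use assms in auto)
    moreover have "real (card L) * (1 - (p - w)) - real (card L) * w = b"
      unfolding s(2) ps[symmetric] by (simp add: algebra_simps)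
    ultimately have "outcome.prob {\<omega>. (\<Sum>j\<in>L. of_bool (rank j \<omega> \<in> {p - w<..})) \<le> real b} \<le> exp (- 2 * s * w\<^sup>2)"
      by (simp only: s(2))
    moreover have "outcome.prob (Collect D) \<le> outcome.prob {\<omega>. (\<Sum>j\<in>L. of_bool (rank j \<omega> \<in> {p - w<..})) \<le> real b}"
      by (intro outcome.finite_measure_mono event_Collect) (auto simp: D_def)
    ultimately show ?thesis by simp
  next
    case False
    have "AE \<omega> in \<Omega>. \<not> D \<omega>"
      using AE_regular
    proof eventually_elim
      case (elim \<omega>)
      have "rank j \<omega> \<in> {p - w<..}" for j using regularD(3)[OF elim, of j] False by simp
      then show ?case using \<open>real b \<le> s\<close> s by (simp add: D_def)
    qed
    from outcome.prob_eq_0_AE[OF this] have "outcome.prob (Collect D) = 0" by simp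
    then show ?thesis by (simp only: exp_ge_zero)
  qed
  ultimately show ?thesis unfolding s_def by linarith
qed

lemma length_filter_map_upt:
  "real (length (filter P (map f [m..<n]))) = (\<Sum>j\<in>{m..<n}. of_bool (P (f j)))"
  by (induction n) (auto simp: atLeastLessThanSuc)

abbreviation future :: "nat \<Rightarrow> nat \<Rightarrow> outcome \<Rightarrow> real list" where
  "future T t \<omega> \<equiv> map (\<lambda>j. \<omega> (Ability j)) [t+1..<T+1]"

lemma marginal_future_eq_quantile:
  assumes "regular \<omega>" "t < T" "1 \<le> b" "b \<le> T - t"
  obtains U where "0 < U" "U \<le> 1" "marginal b (future T t \<omega>) = quantile \<mu> U"
    "\<forall>w. 1 - b / real (T - t) + w \<le> U \<or> U \<le> 1 - b / real (T - t) - w \<longrightarrow> tail T t b w \<omega>"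
proof -
  define us where "us = map (\<lambda>j. rank j \<omega>) [t+1..<T+1]"
  define U where "U = rev (sort us) ! (b - 1)"
  have len: "b \<le> length us" using assms by (simp add: us_def)
  have "U \<in> set us"
    using nth_mem[of "b - 1" "rev (sort us)"] len assms(3) by (simp add: U_def)
  then have U: "0 < U" "U \<le> 1" using regularD(3,4)[OF assms(1)] by (auto simp: us_def)
  let ?f = "\<lambda>q. quantile \<mu> (min q 1)"
  have "future T t \<omega> = map ?f us"
    using regularD(4,5)[OF assms(1)] by (simp add: us_def min_absorb1)
  moreover have "marginal b (map ?f us) = ?f U"
    unfolding U_def using len assms(3)
    by (intro marginal_map_mono monoI quantile_mono quantile_nonneg) auto
  ultimately have "marginal b (future T t \<omega>) = quantile \<mu> U" using U by simp
  moreover have "tail T t b w \<omega>" if "1 - b / real (T - t) + w \<le> U \<or> U \<le> 1 - b / real (T - t) - w" for w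
    using that
  proof
    assume "1 - b / real (T - t) + w \<le> U"
    then have "b \<le> length (filter (\<lambda>u. 1 - b / real (T - t) + w \<le> u) us)"
      by (intro le_order_stat_imp_count assms len) (auto simp: U_def)
    then have "real b \<le> real (length (filter (\<lambda>u. 1 - b / real (T - t) + w \<le> u) us))" by simp
    then show ?thesis unfolding us_def length_filter_map_upt tail_def by simp
  next
    assume "U \<le> 1 - b / real (T - t) - w"
    then have "length (filter (\<lambda>u. 1 - b / real (T - t) - w < u) us) < b"
      by (intro order_stat_imp_count_less assms len) (auto simp: U_def)
    then have "real (length (filter (\<lambda>u. 1 - b / real (T - t) - w < u) us)) < real b" by simp
    then show ?thesis unfolding us_def length_filter_map_upt tail_def by simp
  qed
  ultimately show ?thesis using U that by blast
qed

lemma opt_measurable: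
  assumes "\<And>j. j \<in> set js \<Longrightarrow> X j \<in> borel_measurable M"
  shows "(\<lambda>\<omega>. opt b (map (\<lambda>j. X j \<omega>) js)) \<in> borel_measurable M"
  using assms
proof (induction js arbitrary: b)
  case (Cons j js)
  then show ?case by (cases b) auto
qed simp

lemma marginal_measurable:
  assumes "\<And>j. j \<in> set js \<Longrightarrow> X j \<in> borel_measurable M"
  shows "(\<lambda>\<omega>. marginal b (map (\<lambda>j. X j \<omega>) js)) \<in> borel_measurable M"
  unfolding marginal_def using assms by (intro borel_measurable_diff opt_measurable)

text \<open>The loss, with respect to the optimum in hindsight for budget \<open>b\<close>, of accepting exactly the ranks above \<open>r\<close>.\<close>
definition threshold_loss :: "nat \<Rightarrow> nat \<Rightarrow> nat \<Rightarrow> real \<Rightarrow> outcome \<Rightarrow> real" where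
  "threshold_loss T t b r \<omega> =
    (if r < rank t \<omega> then max 0 (marginal b (future T t \<omega>) - \<omega> (Ability t))
     else max 0 (\<omega> (Ability t) - marginal b (future T t \<omega>)))"

lemma threshold_loss_measurable:
  assumes "\<And>j. t \<le> j \<Longrightarrow> Ability j \<in> I" "Auxiliary t \<in> I"
  shows "threshold_loss T t b r \<in> borel_measurable (coords I)"
proof -
  have [measurable]: "rank t \<in> borel_measurable (coords I)" using assms by (intro rank_measurable) auto
  have [measurable]: "(\<lambda>\<omega>. \<omega> (Ability t)) \<in> borel_measurable (coords I)"
    using assms by (intro measurable_coordinate) auto
  have [measurable]: "(\<lambda>\<omega>. marginal b (future T t \<omega>)) \<in> borel_measurable (coords I)"
    using assms by (intro marginal_measurable measurable_coordinate) auto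
  show ?thesis unfolding threshold_loss_def[abs_def] by measurable
qed

lemma marginal_coordinates_bounds:
  assumes "regular \<omega>" "1 \<le> b"
  shows "0 \<le> marginal b (map (\<lambda>j. \<omega> (X j)) js)" "marginal b (map (\<lambda>j. \<omega> (X j)) js) \<le> 1"
  using assms by (auto intro!: marginal_bounds simp: regularD)

lemma threshold_loss_bounds:
  assumes "regular \<omega>" "1 \<le> b"
  shows "0 \<le> threshold_loss T t b r \<omega>" "threshold_loss T t b r \<omega> \<le> 1"
  using marginal_coordinates_bounds[OF assms, of Ability "[t+1..<T+1]"] regularD(1,2)[OF assms(1), of "Ability t"]
  by (auto simp: threshold_loss_def)

lemma integrable_threshold_loss:
  assumes "1 \<le> b"
  shows "integrable \<Omega> (threshold_loss T t b r)"
proof (rule integrable_bounded[where c = 1])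
  show "threshold_loss T t b r \<in> borel_measurable \<Omega>"
    by (rule measurable_coords_\<Omega>[OF threshold_loss_measurable[of t UNIV]]) auto
  show "AE \<omega> in \<Omega>. \<bar>threshold_loss T t b r \<omega>\<bar> \<le> 1"
    using AE_regular threshold_loss_bounds[OF _ assms] by (auto elim!: eventually_mono)
qed

lemma expectation_threshold_loss_le:
  assumes "clustered C0 \<beta> \<epsilon>0 \<delta> \<mu>" "0 \<le> \<beta>" "0 < \<epsilon>0" "0 \<le> \<delta>" "0 < w"
    and "t < T" "1 \<le> b" "b \<le> T - t"
  obtains r where "outcome.expectation (threshold_loss T t b r)
    \<le> 2 * w * (\<bar>C0\<bar> * (2 * w) powr (1 / (\<beta> + 1)) + \<delta>)
      + 2 * exp (- 2 * real (T - t) * w\<^sup>2) + 2 * exp (- 2 * real (T - t) * (\<epsilon>0 / 2)\<^sup>2)"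
proof -
  define p where "p = 1 - b / real (T - t)"
  define H where "H = \<bar>C0\<bar> * (2 * w) powr (1 / (\<beta> + 1)) + \<delta>"
  have H: "0 \<le> H" using assms by (simp add: H_def)
  obtain r where r: "\<And>u U. 0 < u \<Longrightarrow> u \<le> 1 \<Longrightarrow> 0 < U \<Longrightarrow> U \<le> 1 \<Longrightarrow>
    (if r < u then max 0 (quantile \<mu> U - quantile \<mu> u) else max 0 (quantile \<mu> u - quantile \<mu> U))
    \<le> H * of_bool (p - w \<le> u \<and> u \<le> p + w)
      + of_bool (p + w \<le> U \<or> U \<le> p - w) + of_bool (p + \<epsilon>0 / 2 \<le> U \<or> U \<le> p - \<epsilon>0 / 2)"
    unfolding H_def using cluster_threshold[OF assms(1-4), of w p] assms(5) by auto
  let ?bound = "\<lambda>\<omega>. H * of_bool (p - w \<le> rank t \<omega> \<and> rank t \<omega> \<le> p + w)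
      + of_bool (tail T t b w \<omega>) + of_bool (tail T t b (\<epsilon>0 / 2) \<omega>) :: real"
  have int: "integrable \<Omega> (\<lambda>\<omega>. of_bool (P \<omega>) :: real)" if [measurable]: "Measurable.pred \<Omega> P" for P
    by (rule integrable_bounded[where c = 1]) auto
  have near: "integrable \<Omega> (\<lambda>\<omega>. of_bool (p - w \<le> rank t \<omega> \<and> rank t \<omega> \<le> p + w) :: real)"
    by (rule int) measurable
  have far: "integrable \<Omega> (\<lambda>\<omega>. of_bool (tail T t b w \<omega>) :: real)"
    by (rule int) measurable
  have beyond: "integrable \<Omega> (\<lambda>\<omega>. of_bool (tail T t b (\<epsilon>0 / 2) \<omega>) :: real)"
    by (rule int) measurable
  have "outcome.expectation (threshold_loss T t b r) \<le> outcome.expectation ?bound"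
  proof (rule integral_mono_AE)
    show "integrable \<Omega> (threshold_loss T t b r)" by (rule integrable_threshold_loss) fact
    show "integrable \<Omega> ?bound" by (intro Bochner_Integration.integrable_add integrable_mult_right near far beyond)
    show "AE \<omega> in \<Omega>. threshold_loss T t b r \<omega> \<le> ?bound \<omega>"
      using AE_regular
    proof eventually_elim
      case (elim \<omega>)
      obtain U where U: "0 < U" "U \<le> 1" "marginal b (future T t \<omega>) = quantile \<mu> U"
        "\<forall>w. p + w \<le> U \<or> U \<le> p - w \<longrightarrow> tail T t b w \<omega>"
        by (rule marginal_future_eq_quantile[OF elim assms(6-8), folded p_def])
      have "threshold_loss T t b r \<omega> \<le> H * of_bool (p - w \<le> rank t \<omega> \<and> rank t \<omega> \<le> p + w)
        + of_bool (p + w \<le> U \<or> U \<le> p - w) + of_bool (p + \<epsilon>0 / 2 \<le> U \<or> U \<le> p - \<epsilon>0 / 2)"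
        unfolding threshold_loss_def U(3) regularD(5)[OF elim, of t, symmetric]
        by (rule r) (use U elim in \<open>simp_all add: regularD\<close>)
      also have "\<dots> \<le> ?bound \<omega>"
        using U(4)[rule_format, of w] U(4)[rule_format, of "\<epsilon>0 / 2"] by (intro add_mono order_refl) (simp_all add: of_bool_def)
      finally show ?case .
    qed
  qed
  also have "\<dots> = H * outcome.prob {\<omega>. p - w \<le> rank t \<omega> \<and> rank t \<omega> \<le> p + w}
      + outcome.prob {\<omega>. tail T t b w \<omega>} + outcome.prob {\<omega>. tail T t b (\<epsilon>0 / 2) \<omega>}"
    by (simp add: near far beyond expectation_of_bool)
  also have "\<dots> \<le> H * (2 * w) + 2 * exp (- 2 * real (T - t) * w\<^sup>2) + 2 * exp (- 2 * real (T - t) * (\<epsilon>0 / 2)\<^sup>2)"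
    using prob_rank_between_le[of "p - w" "p + w" t] assms H
    by (intro add_mono mult_left_mono prob_tail_le) auto
  finally show ?thesis by (intro that[of r]) (simp add: H_def mult.commute mult.left_commute)
qed

end

section \<open>Sampling error of the simulated futures\<close>

context ability_law
begin

lemma expectation_reindex:
  assumes "inj_on \<kappa> J" "\<And>j. j \<in> J \<Longrightarrow> source_law \<mu> (\<kappa> j) = \<mu>" "f \<in> borel_measurable (PiM J (\<lambda>_. \<mu>))"
  shows "outcome.expectation (\<lambda>\<omega>. f (\<lambda>j\<in>J. \<omega> (\<kappa> j))) = (\<integral>x. (f x :: real) \<partial>PiM J (\<lambda>_. \<mu>))"
proof -
  have eq: "PiM J (\<lambda>j. source_law \<mu> (\<kappa> j)) = PiM J (\<lambda>_. \<mu>)"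
    using assms(2) by (intro PiM_cong) auto
  have "distr \<Omega> (PiM J (\<lambda>j. source_law \<mu> (\<kappa> j))) (\<lambda>\<omega>. \<lambda>j\<in>J. \<omega> (\<kappa> j)) = PiM J (\<lambda>j. source_law \<mu> (\<kappa> j))"
    unfolding outcome_space_def
    by (intro distr_PiM_reindex) (use assms(1) in \<open>auto simp: prob_space_source_law\<close>)
  then have "(\<integral>x. f x \<partial>PiM J (\<lambda>_. \<mu>)) = (\<integral>x. f x \<partial>distr \<Omega> (PiM J (\<lambda>_. \<mu>)) (\<lambda>\<omega>. \<lambda>j\<in>J. \<omega> (\<kappa> j)))"
    unfolding eq by simp
  also have "\<dots> = outcome.expectation (\<lambda>\<omega>. f (\<lambda>j\<in>J. \<omega> (\<kappa> j)))"
    by (intro integral_distr assms(3) measurable_restrict) simp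
  finally show ?thesis by simp
qed

definition mean_marginal :: "nat \<Rightarrow> nat \<Rightarrow> nat \<Rightarrow> real" where
  "mean_marginal T t b = outcome.expectation (\<lambda>\<omega>. marginal b (future T t \<omega>))"

text \<open>Simulated and true futures have the same law, both being images of the product measure under an injective choice of
sources.\<close>
lemma expectation_marginal_simulated:
  "outcome.expectation (\<lambda>\<omega>. marginal b (simulated_future T t i \<omega>)) = mean_marginal T t b"
proof -
  let ?J = "set [t+1..<T+1]"
  let ?f = "\<lambda>x. marginal b (map x [t+1..<T+1])"
  have f: "?f \<in> borel_measurable (PiM ?J (\<lambda>_. \<mu>))"
  proof (rule marginal_measurable)
    fix j assume "j \<in> ?J"
    then have "(\<lambda>x. x j) \<in> measurable (PiM ?J (\<lambda>_. \<mu>)) \<mu>" by (rule measurable_component_singleton)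
    then show "(\<lambda>x. x j) \<in> borel_measurable (PiM ?J (\<lambda>_. \<mu>))" by (simp cong: measurable_cong_sets)
  qed
  have eq: "?f (\<lambda>j\<in>?J. \<omega> (\<kappa> j)) = marginal b (map (\<lambda>j. \<omega> (\<kappa> j)) [t+1..<T+1])" for \<kappa> \<omega>
    by (intro arg_cong[where f = "marginal b"] map_cong) auto
  have "outcome.expectation (\<lambda>\<omega>. marginal b (simulated_future T t i \<omega>)) = (\<integral>x. ?f x \<partial>PiM ?J (\<lambda>_. \<mu>))"
    unfolding simulated_future_def eq[of _ "Simulated t i", symmetric]
    by (rule expectation_reindex[OF _ _ f]) (auto simp: inj_on_def)
  also have "\<dots> = mean_marginal T t b"
    unfolding mean_marginal_def eq[of _ Ability, symmetric]
    by (rule expectation_reindex[OF _ _ f, symmetric]) (auto simp: inj_on_def)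
  finally show ?thesis .
qed

lemma marginal_simulated_measurable:
  assumes "\<And>j. Simulated t i j \<in> I"
  shows "(\<lambda>\<omega>. marginal b (simulated_future T t i \<omega>)) \<in> borel_measurable (coords I)"
  unfolding simulated_future_def using assms by (intro marginal_measurable measurable_coordinate)

lemma marginal_coordinates_measurable_\<Omega>:
  "(\<lambda>\<omega>. marginal b (map (\<lambda>j. \<omega> (\<kappa> j)) js)) \<in> borel_measurable \<Omega>"
  by (intro marginal_measurable) simp

lemma integrable_marginal:
  assumes "1 \<le> b"
  shows "integrable \<Omega> (\<lambda>\<omega>. marginal b (map (\<lambda>j. \<omega> (\<kappa> j)) js))"
proof (rule integrable_bounded[OF marginal_coordinates_measurable_\<Omega>])
  show "AE \<omega> in \<Omega>. \<bar>marginal b (map (\<lambda>j. \<omega> (\<kappa> j)) js)\<bar> \<le> 1"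
    using AE_regular
  proof eventually_elim
    case (elim \<omega>)
    then show ?case using marginal_coordinates_bounds[OF elim assms, of \<kappa> js] by simp
  qed
qed

lemma mean_marginal_bounds:
  assumes "1 \<le> b"
  shows "0 \<le> mean_marginal T t b" "mean_marginal T t b \<le> 1"
proof -
  show "0 \<le> mean_marginal T t b"
    unfolding mean_marginal_def
    by (rule integral_nonneg_AE, rule eventually_mono[OF AE_regular], rule marginal_coordinates_bounds(1)[OF _ assms])
  have "mean_marginal T t b \<le> outcome.expectation (\<lambda>_. 1)"
    unfolding mean_marginal_def
    by (rule integral_mono_AE, rule integrable_marginal[OF assms], simp,
      rule eventually_mono[OF AE_regular], rule marginal_coordinates_bounds(2)[OF _ assms])
  then show "mean_marginal T t b \<le> 1" by simp
qed

definition estimate :: "nat \<Rightarrow> nat \<Rightarrow> nat \<Rightarrow> nat \<Rightarrow> outcome \<Rightarrow> real" where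
  "estimate k T t b \<omega> = (\<Sum>i=1..k. marginal b (simulated_future T t i \<omega>)) / k"

lemma estimate_measurable:
  assumes "\<And>i j. Simulated t i j \<in> I"
  shows "estimate k T t b \<in> borel_measurable (coords I)"
  unfolding estimate_def[abs_def] using assms
  by (intro borel_measurable_divide borel_measurable_sum marginal_simulated_measurable) auto

text \<open>The simulated value of keeping the full budget exceeds that of giving up one unit by the average marginal value, so
the scores compare the ability with \<open>estimate\<close>.\<close>
lemma score_difference:
  assumes "regular \<omega>" "1 \<le> b" "1 \<le> K t"
  shows "accept_score K T b t \<omega> - reject_score K T b t \<omega> = \<omega> (Ability t) - estimate (K t) T t b \<omega>"
proof -
  have V: "V_hs b' (simulated_future T t i \<omega>) = opt b' (simulated_future T t i \<omega>)" for b' i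
    using assms(1) by (intro V_hs_eq_opt) (auto simp: simulated_future_def regularD)
  have k: "real (K t) > 0" using assms(3) by simp
  have "accept_score K T b t \<omega> - reject_score K T b t \<omega>
     = (\<Sum>i=1..K t. \<omega> (Ability t) - marginal b (simulated_future T t i \<omega>)) / K t"
    unfolding accept_score_def reject_score_def V marginal_def diff_divide_distrib[symmetric]
      sum_subtractf[symmetric] by (simp add: algebra_simps)
  also have "\<dots> = \<omega> (Ability t) - estimate (K t) T t b \<omega>"
    using k by (simp add: sum_subtractf estimate_def diff_divide_distrib)
  finally show ?thesis .
qed

lemma estimate_bounds:
  assumes "regular \<omega>" "1 \<le> b" "1 \<le> k"
  shows "0 \<le> estimate k T t b \<omega>" "estimate k T t b \<omega> \<le> 1"
proof -
  note bd = marginal_coordinates_bounds[OF assms(1,2), of "Simulated t _", folded simulated_future_def]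
  show "0 \<le> estimate k T t b \<omega>"
    unfolding estimate_def using bd(1) by (intro divide_nonneg_nonneg sum_nonneg) (auto simp: simulated_future_def)
  have "(\<Sum>i=1..k. marginal b (simulated_future T t i \<omega>)) \<le> (\<Sum>i=1..k. 1)"
    using bd(2) by (intro sum_mono) (auto simp: simulated_future_def)
  then show "estimate k T t b \<omega> \<le> 1" using assms(3) by (simp add: estimate_def divide_le_eq)
qed

lemma integrable_sampling_error:
  assumes "1 \<le> b" "1 \<le> k"
  shows "integrable \<Omega> (\<lambda>\<omega>. \<bar>mean_marginal T t b - estimate k T t b \<omega>\<bar>)"
proof (rule integrable_bounded[where c = 1])
  have [measurable]: "estimate k T t b \<in> borel_measurable \<Omega>"
    by (rule measurable_coords_\<Omega>[OF estimate_measurable[of t UNIV]]) auto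
  show "(\<lambda>\<omega>. \<bar>mean_marginal T t b - estimate k T t b \<omega>\<bar>) \<in> borel_measurable \<Omega>" by measurable
  show "AE \<omega> in \<Omega>. \<bar>\<bar>mean_marginal T t b - estimate k T t b \<omega>\<bar>\<bar> \<le> 1"
    using AE_regular
  proof eventually_elim
    case (elim \<omega>)
    show ?case
      using estimate_bounds[OF elim assms, of T t] mean_marginal_bounds[OF assms(1), of T t] by linarith
  qed
qed

lemma expectation_sampling_error_le:
  assumes "1 \<le> b" "1 \<le> k"
  shows "outcome.expectation (\<lambda>\<omega>. \<bar>mean_marginal T t b - estimate k T t b \<omega>\<bar>) \<le> 1 / sqrt k"
proof -
  let ?m = "mean_marginal T t b"
  let ?X = "\<lambda>i \<omega>. marginal b (simulated_future T t i \<omega>) - ?m"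
  have k: "real k > 0" using assms by simp
  have "outcome.expectation (\<lambda>\<omega>. \<bar>\<Sum>i\<in>{1..k}. ?X i \<omega>\<bar>) \<le> sqrt (card {1..k})"
  proof (rule expectation_abs_sum_le_sqrt)
    show "disjoint_family_on (\<lambda>i. range (Simulated t i)) {1..k}"
      by (auto simp: disjoint_family_on_def)
    show "?X i \<in> borel_measurable (coords (range (Simulated t i)))" for i
      by (intro borel_measurable_diff marginal_simulated_measurable) auto
    show "AE \<omega> in \<Omega>. \<bar>?X i \<omega>\<bar> \<le> 1" for i
      using AE_regular
    proof eventually_elim
      case (elim \<omega>)
      show ?case
        using marginal_coordinates_bounds[OF elim assms(1), of "Simulated t i" "[t+1..<T+1]"]
          mean_marginal_bounds[OF assms(1), of T t] unfolding simulated_future_def by linarith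
    qed
    have "integrable \<Omega> (\<lambda>\<omega>. marginal b (simulated_future T t i \<omega>))" for i
      unfolding simulated_future_def by (rule integrable_marginal) fact
    then show "outcome.expectation (?X i) = 0" for i
      by (simp add: expectation_marginal_simulated)
  qed simp
  then have le: "outcome.expectation (\<lambda>\<omega>. \<bar>\<Sum>i\<in>{1..k}. ?X i \<omega>\<bar>) \<le> sqrt k" by simp
  have eq: "\<bar>?m - estimate k T t b \<omega>\<bar> = \<bar>\<Sum>i\<in>{1..k}. ?X i \<omega>\<bar> / k" for \<omega>
  proof -
    have "(\<Sum>i\<in>{1..k}. ?X i \<omega>) = k * (estimate k T t b \<omega> - ?m)"
      using k by (simp add: sum_subtractf estimate_def field_simps)
    then show ?thesis using k by (simp add: abs_mult abs_minus_commute)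
  qed
  have "outcome.expectation (\<lambda>\<omega>. \<bar>?m - estimate k T t b \<omega>\<bar>) \<le> sqrt k / k"
    unfolding eq using le k by (simp add: divide_right_mono)
  also have "sqrt k / k = 1 / sqrt k" using k by (simp add: real_div_sqrt field_simps)
  finally show ?thesis .
qed

end

section \<open>Decomposition of the regret\<close>

locale rams_policy = ability_law +
  fixes \<epsilon>0 :: real and K :: "nat \<Rightarrow> nat" and B T :: nat and \<pi> :: policy
  assumes rams: "rams \<mu> \<epsilon>0 K B T \<pi>"
    and K_pos: "\<And>t. t \<in> {1..switch_time \<epsilon>0 T} \<Longrightarrow> 1 \<le> K t"
begin

abbreviation \<tau> :: nat where "\<tau> \<equiv> switch_time \<epsilon>0 T"

abbreviation budget :: "nat \<Rightarrow> outcome \<Rightarrow> nat" where "budget \<equiv> remaining_budget B \<pi>"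

lemma \<tau>_le: "\<tau> \<le> T"
  by (simp add: switch_time_def)

lemma policy_measurable:
  assumes "t \<in> {1..T}"
  shows "Measurable.pred (coords {x. stage x \<le> t}) (\<pi> t)"
  using rams assms by (simp add: rams_def nonanticipating_def history_eq_coords)

lemma budget_1 [simp]: "budget 1 \<omega> = B"
  by (simp add: remaining_budget_def)

lemma budget_Suc:
  assumes "1 \<le> t"
  shows "budget (t + 1) \<omega> = budget t \<omega> - of_bool (\<pi> t \<omega>)"
proof -
  have "{s \<in> {1..<t+1}. \<pi> s \<omega>} = (if \<pi> t \<omega> then insert t {s \<in> {1..<t}. \<pi> s \<omega>} else {s \<in> {1..<t}. \<pi> s \<omega>})"
    using assms by (auto simp: less_Suc_eq)
  then show ?thesis by (simp add: remaining_budget_def)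
qed

lemma budget_le: "budget t \<omega> \<le> B"
  by (simp add: remaining_budget_def)

lemma budget_measurable:
  assumes "1 \<le> t" "t \<le> T + 1"
  shows "budget t \<in> measurable (coords {x. stage x < t}) (count_space UNIV)"
  using assms
proof (induction t rule: dec_induct)
  case base
  then show ?case by (simp del: One_nat_def add: fun_eq_iff[of "budget 1", THEN iffD2, of "\<lambda>_. B"])
next
  case (step t)
  have [measurable]: "budget t \<in> measurable (coords {x. stage x < Suc t}) (count_space UNIV)"
    using step by (intro measurable_coords_mono[OF step.IH]) auto
  have [measurable]: "Measurable.pred (coords {x. stage x < Suc t}) (\<pi> t)"
    using step by (intro measurable_coords_mono[OF policy_measurable]) auto
  have "budget (Suc t) = (\<lambda>\<omega>. if \<pi> t \<omega> then budget t \<omega> - 1 else budget t \<omega>)"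
    using budget_Suc[of t] step by (auto simp: fun_eq_iff)
  then show ?case by simp
qed

text \<open>The optimum in hindsight for the candidates from time \<open>t\<close> on, with the budget that the policy has left.\<close>
definition value_to_go :: "nat \<Rightarrow> outcome \<Rightarrow> real" where
  "value_to_go t \<omega> = opt (budget t \<omega>) (map (\<lambda>j. \<omega> (Ability j)) [t..<T+1])"

definition step_loss :: "nat \<Rightarrow> outcome \<Rightarrow> real" where
  "step_loss t \<omega> = value_to_go t \<omega> - \<omega> (Ability t) * of_bool (\<pi> t \<omega>) - value_to_go (t + 1) \<omega>"

lemma sum_step_loss:
  "(\<Sum>t=1..n. step_loss t \<omega>) =
    value_to_go 1 \<omega> - (\<Sum>t=1..n. \<omega> (Ability t) * of_bool (\<pi> t \<omega>)) - value_to_go (n + 1) \<omega>"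
  by (induction n) (auto simp: step_loss_def)

definition accept_above :: "nat \<Rightarrow> real \<Rightarrow> outcome \<Rightarrow> real" where
  "accept_above t r \<omega> = of_bool (r < rank t \<omega>)"

text \<open>The two possible losses differ by the marginal value minus the ability, so passing from the threshold rule to RAMS
adds \<open>(a - c) * (Z - \<theta>)\<close>; RAMS makes this nonpositive when \<open>Z\<close> is replaced by its estimate. The
difference between \<open>Z\<close> and its estimate is split at the mean, since the policy's decision is independent of the
true future but not of the simulated ones.\<close>
lemma step_loss_le:
  assumes "regular \<omega>" "t \<in> {1..\<tau>}"
  defines "b \<equiv> budget t \<omega>"
  shows "b = 0 \<Longrightarrow> step_loss t \<omega> = 0"
    and "1 \<le> b \<Longrightarrow> step_loss t \<omega> \<le> threshold_loss T t b r \<omega>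
      + (of_bool (\<pi> t \<omega>) - accept_above t r \<omega>) * (marginal b (future T t \<omega>) - mean_marginal T t b)
      + \<bar>mean_marginal T t b - estimate (K t) T t b \<omega>\<bar>"
proof -
  have "\<forall>t\<in>{1..\<tau>}. (\<pi> t \<omega> \<longrightarrow> budget t \<omega> \<ge> 1 \<and> accept_score K T (budget t \<omega>) t \<omega> \<ge> reject_score K T (budget t \<omega>) t \<omega>) \<and>
     (\<not> \<pi> t \<omega> \<longrightarrow> budget t \<omega> = 0 \<or> reject_score K T (budget t \<omega>) t \<omega> \<ge> accept_score K T (budget t \<omega>) t \<omega>)"
    using rams unfolding rams_def Let_def by simp
  then have acc: "\<pi> t \<omega> \<Longrightarrow> 1 \<le> b \<and> accept_score K T b t \<omega> \<ge> reject_score K T b t \<omega>"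
    and rej: "\<not> \<pi> t \<omega> \<Longrightarrow> b = 0 \<or> reject_score K T b t \<omega> \<ge> accept_score K T b t \<omega>"
    using assms(2) unfolding b_def by blast+
  have t: "1 \<le> t" "t \<le> T" using assms(2) \<tau>_le by auto
  have upt: "[t..<T+1] = t # [t+1..<T+1]" using t by (simp add: upt_rec)
  define Z where "Z = marginal b (future T t \<omega>)"
  define \<theta> where "\<theta> = \<omega> (Ability t)"
  have vt: "value_to_go t \<omega> = opt b (\<theta> # future T t \<omega>)"
    unfolding value_to_go_def upt b_def \<theta>_def by simp
  have vt': "value_to_go (t + 1) \<omega> = opt (b - of_bool (\<pi> t \<omega>)) (future T t \<omega>)"
    unfolding value_to_go_def budget_Suc[OF t(1)] b_def by simp
  show "step_loss t \<omega> = 0" if "b = 0"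
  proof -
    have "\<not> \<pi> t \<omega>" using that acc by auto
    then show ?thesis unfolding step_loss_def vt vt' using that by simp
  qed
  assume b: "1 \<le> b"
  have "opt b (\<theta> # future T t \<omega>) = max (\<theta> + opt (b - 1) (future T t \<omega>)) (opt b (future T t \<omega>))"
    using b by (cases b) auto
  then have loss: "step_loss t \<omega> = (if \<pi> t \<omega> then max 0 (Z - \<theta>) else max 0 (\<theta> - Z))"
    unfolding step_loss_def vt vt' Z_def marginal_def \<theta>_def[symmetric] by (auto simp: max_def simp del: upt_Suc)
  have score: "accept_score K T b t \<omega> - reject_score K T b t \<omega> = \<theta> - estimate (K t) T t b \<omega>"
    unfolding \<theta>_def using assms b K_pos by (intro score_difference) auto
  show "step_loss t \<omega> \<le> threshold_loss T t b r \<omega>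
      + (of_bool (\<pi> t \<omega>) - accept_above t r \<omega>) * (marginal b (future T t \<omega>) - mean_marginal T t b)
      + \<bar>mean_marginal T t b - estimate (K t) T t b \<omega>\<bar>"
    unfolding loss threshold_loss_def accept_above_def Z_def[symmetric] \<theta>_def[symmetric]
    using acc rej b score by (cases "\<pi> t \<omega>"; cases "r < rank t \<omega>") (auto simp: max_def abs_if)
qed

end

context ability_law
begin

lemma integrable_of_bool:
  assumes "Measurable.pred \<Omega> P"
  shows "integrable \<Omega> (\<lambda>\<omega>. of_bool (P \<omega>) :: real)"
  using assms by (intro integrable_bounded[where c = 1]) auto

text \<open>With more budget than candidates left the marginal value is zero, in the true future and in all simulated ones.
The threshold \<open>-1\<close> accepts everybody.\<close>
lemma slack_budget_losses:
  assumes "T - t < b" "1 \<le> k"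
  shows "outcome.expectation (threshold_loss T t b (- 1))
    + outcome.expectation (\<lambda>\<omega>. \<bar>mean_marginal T t b - estimate k T t b \<omega>\<bar>) \<le> 0"
proof -
  have zero: "marginal b (map (\<lambda>j. \<omega> (\<kappa> j)) [t+1..<T+1]) = 0" if "regular \<omega>" for \<omega> and \<kappa> :: "nat \<Rightarrow> source"
    using assms that by (subst marginal_eq) (auto simp: regularD simp del: upt_Suc)
  have "mean_marginal T t b = 0"
    unfolding mean_marginal_def
    by (rule integral_eq_zero_AE, rule eventually_mono[OF AE_regular], rule zero)
  then have "\<bar>mean_marginal T t b - estimate k T t b \<omega>\<bar> = 0" if "regular \<omega>" for \<omega>
    unfolding estimate_def simulated_future_def using zero[OF that] by simp
  then have "outcome.expectation (\<lambda>\<omega>. \<bar>mean_marginal T t b - estimate k T t b \<omega>\<bar>) = 0"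
    by (intro integral_eq_zero_AE eventually_mono[OF AE_regular])
  moreover have "threshold_loss T t b (- 1) \<omega> = 0" if "regular \<omega>" for \<omega>
    unfolding threshold_loss_def zero[OF that] using regularD(1)[OF that, of "Ability t"] regularD(3)[OF that, of t]
    by simp
  then have "outcome.expectation (threshold_loss T t b (- 1)) = 0"
    by (intro integral_eq_zero_AE eventually_mono[OF AE_regular])
  ultimately show ?thesis by simp
qed

end

context rams_policy
begin

lemma budget_indicator_measurable:
  assumes "1 \<le> t" "t \<le> T + 1"
  shows "(\<lambda>\<omega>. of_bool (budget t \<omega> = b) :: real) \<in> borel_measurable (coords {x. stage x < t})"
proof -
  have [measurable]: "budget t \<in> measurable (coords {x. stage x < t}) (count_space UNIV)"
    by (rule budget_measurable) fact+
  show ?thesis by measurable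
qed

lemma sum_budget_indicator:
  "(\<Sum>b\<in>L. of_bool (budget t \<omega> = b) * f b) = (if finite L \<and> budget t \<omega> \<in> L then f (budget t \<omega>) else (0 :: real))"
  by (cases "finite L") (auto simp: of_bool_def if_distrib[of "\<lambda>x. x * _"] sum.delta cong: if_cong)

lemma sum_budget_probabilities_le:
  assumes "1 \<le> t" "t \<le> T + 1"
  shows "(\<Sum>b\<in>{n..B}. outcome.expectation (\<lambda>\<omega>. of_bool (budget t \<omega> = b) :: real)) \<le> 1"
proof -
  have m: "(\<lambda>\<omega>. of_bool (budget t \<omega> = b) :: real) \<in> borel_measurable \<Omega>" for b
    by (rule measurable_coords_\<Omega>[OF budget_indicator_measurable]) fact+
  have int: "integrable \<Omega> (\<lambda>\<omega>. of_bool (budget t \<omega> = b) :: real)" for b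
    by (rule integrable_bounded[OF m, of _ 1]) simp
  have "(\<Sum>b\<in>{n..B}. outcome.expectation (\<lambda>\<omega>. of_bool (budget t \<omega> = b) :: real))
    = outcome.expectation (\<lambda>\<omega>. \<Sum>b\<in>{n..B}. of_bool (budget t \<omega> = b))"
    by (intro Bochner_Integration.integral_sum[symmetric] int)
  also have "\<dots> \<le> outcome.expectation (\<lambda>\<omega>. 1)"
    using sum_budget_indicator[of t _ "\<lambda>_. 1"] by (intro integral_mono Bochner_Integration.integrable_sum int) simp_all
  finally show ?thesis by simp
qed

text \<open>The threshold rule depends on the budget, which is itself random. As the budget takes finitely many values and is
determined before time \<open>t\<close>, each value can be treated separately, and the resulting bounds are averaged with the
probabilities of these values.\<close>
lemma expected_step_loss:
  assumes "t \<in> {1..\<tau>}"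
    and bound: "\<And>b. 1 \<le> b \<Longrightarrow> \<exists>r. outcome.expectation (threshold_loss T t b r)
      + outcome.expectation (\<lambda>\<omega>. \<bar>mean_marginal T t b - estimate (K t) T t b \<omega>\<bar>) \<le> c"
    and "0 \<le> c"
  shows "\<exists>U. integrable \<Omega> U \<and> (AE \<omega> in \<Omega>. step_loss t \<omega> \<le> U \<omega>) \<and> outcome.expectation U \<le> c"
proof -
  have t: "1 \<le> t" "t \<le> T" "t \<le> T + 1" and Kt: "1 \<le> K t" using assms(1) \<tau>_le K_pos by auto
  obtain r where r: "\<And>b. 1 \<le> b \<Longrightarrow> outcome.expectation (threshold_loss T t b (r b))
      + outcome.expectation (\<lambda>\<omega>. \<bar>mean_marginal T t b - estimate (K t) T t b \<omega>\<bar>) \<le> c"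
    using bound by metis
  define e :: "nat \<Rightarrow> outcome \<Rightarrow> real" where "e b \<omega> = of_bool (budget t \<omega> = b)" for b \<omega>
  define D where "D b \<omega> = of_bool (\<pi> t \<omega>) - accept_above t (r b) \<omega>" for b \<omega>
  define Z where "Z b \<omega> = marginal b (future T t \<omega>) - mean_marginal T t b" for b \<omega>
  define S where "S b \<omega> = \<bar>mean_marginal T t b - estimate (K t) T t b \<omega>\<bar>" for b \<omega>
  define l where "l b = threshold_loss T t b (r b)" for b
  define U where "U \<omega> = (\<Sum>b\<in>{1..B}. e b \<omega> * l b \<omega> + (e b \<omega> * D b \<omega>) * Z b \<omega> + e b \<omega> * S b \<omega>)" for \<omega>
  have me: "e b \<in> borel_measurable (coords {x. stage x < t})" for b
    unfolding e_def[abs_def] by (rule budget_indicator_measurable) fact+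
  have me': "e b \<in> borel_measurable (coords {x. stage x \<le> t})" for b
    by (rule measurable_coords_mono[OF me]) auto
  have mD: "D b \<in> borel_measurable (coords {x. stage x \<le> t})" for b
  proof -
    have [measurable]: "Measurable.pred (coords {x. stage x \<le> t}) (\<pi> t)"
      using t by (intro policy_measurable) simp
    have [measurable]: "rank t \<in> borel_measurable (coords {x. stage x \<le> t})"
      by (rule rank_measurable) auto
    show ?thesis unfolding D_def[abs_def] accept_above_def by measurable
  qed
  have meD: "(\<lambda>\<omega>. e b \<omega> * D b \<omega>) \<in> borel_measurable (coords {x. stage x \<le> t})" for b
    by (intro borel_measurable_times me' mD)
  have mZ: "Z b \<in> borel_measurable (coords {x. t < stage x})" for b
    unfolding Z_def[abs_def]
    by (intro borel_measurable_diff borel_measurable_const marginal_measurable measurable_coordinate) auto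
  have ml: "l b \<in> borel_measurable (coords {x. t \<le> stage x})" for b
    unfolding l_def by (rule threshold_loss_measurable) auto
  have mS: "S b \<in> borel_measurable (coords {x. t \<le> stage x})" for b
    unfolding S_def[abs_def]
    by (intro borel_measurable_abs borel_measurable_diff borel_measurable_const estimate_measurable) auto
  have ie: "integrable \<Omega> (e b)" for b
    by (rule integrable_bounded[OF measurable_coords_\<Omega>[OF me], of _ 1]) (simp add: e_def)
  have ieD: "integrable \<Omega> (\<lambda>\<omega>. e b \<omega> * D b \<omega>)" for b
    by (rule integrable_bounded[OF measurable_coords_\<Omega>[OF meD], of _ 1])
      (simp add: e_def D_def accept_above_def of_bool_def)
  have il: "integrable \<Omega> (l b)" and iZ: "integrable \<Omega> (Z b)" and iS: "integrable \<Omega> (S b)" if "1 \<le> b" for b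
    unfolding l_def Z_def[abs_def] S_def[abs_def]
    by (rule integrable_threshold_loss[OF that])
      (rule Bochner_Integration.integrable_diff[OF integrable_marginal[OF that] outcome.integrable_const],
       rule integrable_sampling_error[OF that Kt])
  \<comment> \<open>The decisions up to time \<open>t\<close> are uncorrelated with the future, which removes this term.\<close>
  have EZ: "outcome.expectation (Z b) = 0" if "1 \<le> b" for b
    unfolding Z_def[abs_def]
    by (subst Bochner_Integration.integral_diff[OF integrable_marginal[OF that] outcome.integrable_const])
      (simp add: mean_marginal_def del: upt_Suc)
  have pl: "integrable \<Omega> (\<lambda>\<omega>. e b \<omega> * l b \<omega>)"
    "outcome.expectation (\<lambda>\<omega>. e b \<omega> * l b \<omega>) = outcome.expectation (e b) * outcome.expectation (l b)" if "1 \<le> b" for b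
    by (intro expectation_mult[OF _ me ml ie il[OF that]]; force)+
  have pS: "integrable \<Omega> (\<lambda>\<omega>. e b \<omega> * S b \<omega>)"
    "outcome.expectation (\<lambda>\<omega>. e b \<omega> * S b \<omega>) = outcome.expectation (e b) * outcome.expectation (S b)" if "1 \<le> b" for b
    by (intro expectation_mult[OF _ me mS ie iS[OF that]]; force)+
  have pZ: "integrable \<Omega> (\<lambda>\<omega>. (e b \<omega> * D b \<omega>) * Z b \<omega>)"
    "outcome.expectation (\<lambda>\<omega>. (e b \<omega> * D b \<omega>) * Z b \<omega>) = outcome.expectation (\<lambda>\<omega>. e b \<omega> * D b \<omega>) * outcome.expectation (Z b)" if "1 \<le> b" for b
    by (intro expectation_mult[OF _ meD mZ ieD iZ[OF that]]; force)+
  have term_int: "integrable \<Omega> (\<lambda>\<omega>. e b \<omega> * l b \<omega> + (e b \<omega> * D b \<omega>) * Z b \<omega> + e b \<omega> * S b \<omega>)" if "1 \<le> b" for b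
    by (intro Bochner_Integration.integrable_add pl pS pZ that)
  have "integrable \<Omega> U"
    unfolding U_def[abs_def] by (intro Bochner_Integration.integrable_sum term_int) simp
  moreover have "AE \<omega> in \<Omega>. step_loss t \<omega> \<le> U \<omega>"
    using AE_regular
  proof eventually_elim
    case (elim \<omega>)
    define b where "b = budget t \<omega>"
    have "U \<omega> = (\<Sum>b\<in>{1..B}. of_bool (budget t \<omega> = b) * (l b \<omega> + D b \<omega> * Z b \<omega> + S b \<omega>))"
      unfolding U_def e_def by (intro sum.cong refl) (simp add: algebra_simps)
    also have "\<dots> = (if 1 \<le> b then l b \<omega> + D b \<omega> * Z b \<omega> + S b \<omega> else 0)"
      unfolding sum_budget_indicator b_def using budget_le[of t \<omega>] by simp
    finally show ?case
      using step_loss_le(1)[OF elim assms(1)] step_loss_le(2)[OF elim assms(1), of "r b"] unfolding b_def[symmetric]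
      by (cases "b = 0") (auto simp: l_def D_def Z_def S_def)
  qed
  moreover have "outcome.expectation U \<le> c"
  proof -
    have "outcome.expectation U =
      (\<Sum>b\<in>{1..B}. outcome.expectation (\<lambda>\<omega>. e b \<omega> * l b \<omega> + (e b \<omega> * D b \<omega>) * Z b \<omega> + e b \<omega> * S b \<omega>))"
      unfolding U_def[abs_def] by (rule Bochner_Integration.integral_sum) (use term_int in simp)
    also have "\<dots> \<le> (\<Sum>b\<in>{1..B}. outcome.expectation (e b) * c)"
    proof (rule sum_mono)
      fix b assume "b \<in> {1..B}"
      then have b: "1 \<le> b" by simp
      have "outcome.expectation (\<lambda>\<omega>. e b \<omega> * l b \<omega> + (e b \<omega> * D b \<omega>) * Z b \<omega> + e b \<omega> * S b \<omega>)
        = outcome.expectation (e b) * (outcome.expectation (l b) + outcome.expectation (S b))"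
        using pl[OF b] pS[OF b] pZ[OF b] by (simp add: EZ[OF b] algebra_simps)
      also have "\<dots> \<le> outcome.expectation (e b) * c"
        using r[OF b] by (intro mult_left_mono) (auto simp: l_def S_def[abs_def] e_def)
      finally show "outcome.expectation (\<lambda>\<omega>. e b \<omega> * l b \<omega> + (e b \<omega> * D b \<omega>) * Z b \<omega> + e b \<omega> * S b \<omega>)
        \<le> outcome.expectation (e b) * c" .
    qed
    also have "\<dots> = (\<Sum>b\<in>{1..B}. outcome.expectation (e b)) * c" by (simp add: sum_distrib_right)
    also have "\<dots> \<le> 1 * c"
      using sum_budget_probabilities_le[OF t(1,3), of 1] assms(3)
      unfolding e_def[abs_def] by (intro mult_right_mono) simp_all
    finally show ?thesis by simp
  qed
  ultimately show ?thesis by blast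
qed

section \<open>The static final phase\<close>

text \<open>How many ranks of the static phase reach the threshold in excess of the budget \<open>b\<close>.\<close>
definition excess :: "nat \<Rightarrow> outcome \<Rightarrow> real" where
  "excess b \<omega> = (\<Sum>t\<in>{\<tau>+1..<T+1}. of_bool (rank t \<omega> \<in> {1 - b / real (T - \<tau>)..})) - real b"

definition final_bound :: "nat \<Rightarrow> outcome \<Rightarrow> real" where
  "final_bound b \<omega> = max 0 (excess b \<omega>) - quantile \<mu> (1 - b / real (T - \<tau>)) * excess b \<omega>"

text \<open>Pricing budget at the threshold quantile bounds the optimum by the total of the abilities above the threshold,
corrected by the price times the excess. The policy collects this total apart from the candidates turned away for
lack of budget, whose number is the positive part of the excess.\<close>
lemma final_phase_loss_le:
  assumes "regular \<omega>" "\<tau> < T"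
  shows "value_to_go (\<tau> + 1) \<omega> - (\<Sum>t\<in>{\<tau>+1..<T+1}. \<omega> (Ability t) * of_bool (\<pi> t \<omega>))
    \<le> final_bound (budget (\<tau> + 1) \<omega>) \<omega>"
proof -
  define b where "b = budget (\<tau> + 1) \<omega>"
  define p where "p = 1 - b / real (T - \<tau>)"
  define v where "v = quantile \<mu> p"
  define L where "L = {\<tau>+1..<T+1}"
  have finL: "finite L" by (simp add: L_def)
  define N where "N = (\<Sum>t\<in>L. of_bool (p \<le> rank t \<omega>) :: real)"
  have p1: "p \<le> 1" by (simp add: p_def)
  have v0: "0 \<le> v" unfolding v_def by (rule quantile_nonneg[OF p1])
  have excess: "excess b \<omega> = N - b" by (simp add: excess_def N_def p_def L_def)
  have pol: "\<pi> t \<omega> \<longleftrightarrow> p \<le> rank t \<omega> \<and> 0 < budget t \<omega>" if "t \<in> L" for t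
  proof -
    have "\<forall>t\<in>{\<tau> + 1..T}. \<pi> t \<omega> \<longleftrightarrow>
      quantile_draw \<mu> (\<omega> (Ability t)) (\<omega> (Auxiliary t)) \<ge> p \<and> budget t \<omega> > 0"
      unfolding p_def b_def
      by (rule rams[unfolded rams_def Let_def, THEN conjunct2, THEN bspec, THEN conjunct2]) simp
    then show ?thesis using that by (simp add: regularD(6)[OF assms(1)] L_def)
  qed
  have per_candidate: "max 0 (\<omega> (Ability t) - v) = \<omega> (Ability t) * of_bool (p \<le> rank t \<omega>) - v * of_bool (p \<le> rank t \<omega>)" for t
  proof (cases "p \<le> rank t \<omega>")
    case True
    then have "quantile \<mu> p \<le> quantile \<mu> (rank t \<omega>)"
      using regularD(4)[OF assms(1)] by (rule quantile_mono)
    then show ?thesis using True by (simp add: v_def regularD(5)[OF assms(1)])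
  next
    case False
    then have "quantile \<mu> (rank t \<omega>) \<le> quantile \<mu> p"
      by (intro quantile_mono p1) simp
    then show ?thesis using False by (simp add: v_def regularD(5)[OF assms(1)])
  qed
  have "value_to_go (\<tau> + 1) \<omega> \<le> (\<Sum>x\<leftarrow>map (\<lambda>j. \<omega> (Ability j)) [\<tau>+1..<T+1]. max 0 (x - v)) + v * b"
    unfolding value_to_go_def b_def by (rule opt_le_excess[OF v0])
  moreover have "(\<Sum>x\<leftarrow>map (\<lambda>j. \<omega> (Ability j)) [\<tau>+1..<T+1]. max 0 (x - v)) = (\<Sum>t\<in>L. max 0 (\<omega> (Ability t) - v))"
    unfolding L_def by (simp add: interv_sum_list_conv_sum_set_nat o_def del: upt_Suc)
  moreover have "(\<Sum>t\<in>L. max 0 (\<omega> (Ability t) - v)) = (\<Sum>t\<in>L. \<omega> (Ability t) * of_bool (p \<le> rank t \<omega>)) - v * N"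
    unfolding per_candidate sum_subtractf N_def sum_distrib_left ..
  moreover have "v * (N - b) = v * N - v * b" by (rule right_diff_distrib)
  ultimately have upper: "value_to_go (\<tau> + 1) \<omega> \<le> (\<Sum>t\<in>L. \<omega> (Ability t) * of_bool (p \<le> rank t \<omega>)) - v * (N - b)"
    by linarith
  define A where "A = card {t \<in> L. \<pi> t \<omega>}"
  have A: "(\<Sum>t\<in>L. of_bool (\<pi> t \<omega>) :: real) = A" by (simp add: A_def finL Int_def)
  have "(\<Sum>t\<in>L. \<omega> (Ability t) * of_bool (p \<le> rank t \<omega>)) - (\<Sum>t\<in>L. \<omega> (Ability t) * of_bool (\<pi> t \<omega>))
      = (\<Sum>t\<in>L. \<omega> (Ability t) * (of_bool (p \<le> rank t \<omega>) - of_bool (\<pi> t \<omega>)))"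
    by (simp add: sum_subtractf right_diff_distrib)
  also have "\<dots> \<le> (\<Sum>t\<in>L. 1 * (of_bool (p \<le> rank t \<omega>) - of_bool (\<pi> t \<omega>)))"
  proof (rule sum_mono)
    fix t assume "t \<in> L"
    then have "0 \<le> of_bool (p \<le> rank t \<omega>) - (of_bool (\<pi> t \<omega>) :: real)"
      unfolding pol[OF \<open>t \<in> L\<close>] by (simp add: of_bool_def)
    then show "\<omega> (Ability t) * (of_bool (p \<le> rank t \<omega>) - of_bool (\<pi> t \<omega>))
        \<le> 1 * (of_bool (p \<le> rank t \<omega>) - of_bool (\<pi> t \<omega>))"
      by (intro mult_right_mono regularD(2)[OF assms(1)])
  qed
  also have "\<dots> = N - A"
    unfolding A[symmetric] by (simp add: sum_subtractf N_def)
  also have "\<dots> \<le> max 0 (N - b)"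
  proof (cases "\<forall>t\<in>L. p \<le> rank t \<omega> \<longrightarrow> \<pi> t \<omega>")
    case True
    have "N = A"
      unfolding N_def A[symmetric] by (rule sum.cong[OF refl], rule arg_cong[where f = of_bool]) (metis True pol)
    then show ?thesis by simp
  next
    case False
    then obtain t where t: "t \<in> L" "p \<le> rank t \<omega>" "\<not> \<pi> t \<omega>" by blast
    then have "budget t \<omega> = 0" using pol[OF t(1)] by simp
    then have "B \<le> card {s \<in> {1..<t}. \<pi> s \<omega>}" by (simp add: remaining_budget_def)
    also have "card {s \<in> {1..<t}. \<pi> s \<omega>} \<le> card ({s \<in> {1..<\<tau>+1}. \<pi> s \<omega>} \<union> {t \<in> L. \<pi> t \<omega>})"
      using t(1) by (intro card_mono) (auto simp: L_def)
    also have "\<dots> \<le> card {s \<in> {1..<\<tau>+1}. \<pi> s \<omega>} + A"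
      unfolding A_def by (rule card_Un_le)
    finally have "b \<le> A" by (simp add: b_def remaining_budget_def)
    then show ?thesis by simp
  qed
  finally show ?thesis
    using upper unfolding final_bound_def b_def[symmetric] excess p_def[symmetric] v_def[symmetric] L_def[symmetric]
    by linarith
qed

lemma excess_measurable: "excess b \<in> borel_measurable (coords {x. \<tau> < stage x})"
proof -
  have [measurable]: "rank t \<in> borel_measurable (coords {x. \<tau> < stage x})" if "\<tau> < t" for t
    using that by (intro rank_measurable) auto
  show ?thesis
    unfolding excess_def[abs_def]
    by (intro borel_measurable_diff borel_measurable_sum) auto
qed

lemma final_bound_measurable: "final_bound b \<in> borel_measurable (coords {x. \<tau> < stage x})"
  unfolding final_bound_def[abs_def]
  by (intro borel_measurable_diff borel_measurable_max borel_measurable_times borel_measurable_const excess_measurable)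

lemma integrable_excess: "integrable \<Omega> (excess b)"
proof (rule integrable_bounded[OF measurable_coords_\<Omega>[OF excess_measurable]])
  show "AE \<omega> in \<Omega>. \<bar>excess b \<omega>\<bar> \<le> real T + b"
  proof (rule AE_I2)
    fix \<omega>
    define S where "S = (\<Sum>t\<in>{\<tau>+1..<T+1}. of_bool (rank t \<omega> \<in> {1 - b / real (T - \<tau>)..}) :: real)"
    have "S \<le> (\<Sum>t\<in>{\<tau>+1..<T+1}. 1)" unfolding S_def by (intro sum_mono) auto
    also have "\<dots> \<le> real T" by simp
    finally have "S \<le> real T" .
    moreover have "0 \<le> S" unfolding S_def by (intro sum_nonneg) auto
    moreover have "excess b \<omega> = S - b" unfolding excess_def S_def ..
    ultimately show "\<bar>excess b \<omega>\<bar> \<le> real T + b" by simp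
  qed
qed

lemma integrable_final_bound: "integrable \<Omega> (final_bound b)"
  unfolding final_bound_def[abs_def]
  by (intro Bochner_Integration.integrable_diff integrable_max integrable_mult_right integrable_excess) simp

text \<open>The threshold is chosen such that the excess has mean zero; its mean absolute value is at most its standard
deviation. If the budget exceeds the number of candidates, the price of budget is zero and there is no excess.\<close>
lemma expectation_final_bound_le:
  assumes "\<tau> < T"
  shows "outcome.expectation (final_bound b) \<le> sqrt (T - \<tau>)"
proof -
  define n where "n = real (T - \<tau>)"
  define p where "p = 1 - b / n"
  define L where "L = {\<tau>+1..<T+1}"
  have n: "n > 0" using assms by (simp add: n_def)
  have cL: "real (card L) = n" by (simp add: L_def n_def)
  have exc: "excess b \<omega> = (\<Sum>t\<in>L. of_bool (rank t \<omega> \<in> {p..})) - real b" for \<omega>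
    unfolding excess_def p_def n_def L_def ..
  show ?thesis
  proof (cases "real b \<le> n")
    case True
    then have p: "0 \<le> p" "p \<le> 1" using n by (auto simp: p_def)
    let ?X = "\<lambda>t \<omega>. of_bool (rank t \<omega> \<in> {p..}) - (1 - p) :: real"
    have "(\<Sum>t\<in>L. 1 - p) = b" using n by (simp add: cL p_def)
    then have exc': "excess b \<omega> = (\<Sum>t\<in>L. ?X t \<omega>)" for \<omega> by (simp only: exc sum_subtractf)
    have iX: "integrable \<Omega> (\<lambda>\<omega>. of_bool (rank t \<omega> \<in> {p..}) :: real)" for t
      by (rule integrable_of_bool) measurable
    have EX: "outcome.expectation (?X t) = 0" for t
    proof -
      have "outcome.expectation (\<lambda>\<omega>. of_bool (rank t \<omega> \<in> {p..})) = outcome.prob {\<omega>. rank t \<omega> \<in> {p..}}"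
        by (rule expectation_of_bool) measurable
      also have "\<dots> = 1 - p" using prob_rank_ge[of p t] p by simp
      finally show ?thesis using iX by simp
    qed
    have "outcome.expectation (\<lambda>\<omega>. \<bar>\<Sum>t\<in>L. ?X t \<omega>\<bar>) \<le> sqrt (card L)"
    proof (rule expectation_abs_sum_le_sqrt)
      show "disjoint_family_on (\<lambda>t. {Ability t, Auxiliary t}) L" by (auto simp: disjoint_family_on_def)
      show "?X t \<in> borel_measurable (coords {Ability t, Auxiliary t})" for t
      proof -
        have [measurable]: "rank t \<in> borel_measurable (coords {Ability t, Auxiliary t})" by (rule rank_measurable) auto
        show ?thesis by measurable
      qed
      show "AE \<omega> in \<Omega>. \<bar>?X t \<omega>\<bar> \<le> 1" for t using p by (auto simp: of_bool_def abs_if)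
      show "outcome.expectation (?X t) = 0" for t by (rule EX)
    qed (simp add: L_def)
    then have abs: "outcome.expectation (\<lambda>\<omega>. \<bar>excess b \<omega>\<bar>) \<le> sqrt (T - \<tau>)"
      by (simp add: exc' cL n_def)
    have zero: "outcome.expectation (excess b) = 0"
      unfolding exc' by (subst Bochner_Integration.integral_sum) (use iX EX in \<open>auto intro!: Bochner_Integration.integrable_diff\<close>)
    have "outcome.expectation (final_bound b) = outcome.expectation (\<lambda>\<omega>. max 0 (excess b \<omega>))"
      unfolding final_bound_def[abs_def]
      by (subst Bochner_Integration.integral_diff) (simp_all add: zero integrable_excess)
    also have "\<dots> \<le> outcome.expectation (\<lambda>\<omega>. \<bar>excess b \<omega>\<bar>)"
      by (intro integral_mono integrable_max integrable_abs integrable_excess) auto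
    finally show ?thesis using abs by simp
  next
    case False
    then have p: "p \<le> 0" using n by (simp add: p_def)
    have "excess b \<omega> \<le> 0" for \<omega>
    proof -
      have "(\<Sum>t\<in>L. of_bool (rank t \<omega> \<in> {p..}) :: real) \<le> (\<Sum>t\<in>L. 1)" by (intro sum_mono) auto
      then show ?thesis using False cL by (simp add: exc)
    qed
    then have "final_bound b = (\<lambda>_. 0)"
      by (simp add: max_absorb1 fun_eq_iff final_bound_def n_def[symmetric] p_def[symmetric] quantile_eq_0[OF p])
    then show ?thesis by simp
  qed
qed

lemma expected_final_loss:
  "\<exists>U. integrable \<Omega> U \<and> (AE \<omega> in \<Omega>. value_to_go (\<tau> + 1) \<omega>
      - (\<Sum>t\<in>{\<tau>+1..<T+1}. \<omega> (Ability t) * of_bool (\<pi> t \<omega>)) \<le> U \<omega>)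
    \<and> outcome.expectation U \<le> sqrt (T - \<tau>)"
proof (cases "\<tau> < T")
  case False
  then have "\<tau> = T" using \<tau>_le by simp
  then show ?thesis by (intro exI[of _ "\<lambda>_. 0"]) (simp add: value_to_go_def)
next
  case True
  define e :: "nat \<Rightarrow> outcome \<Rightarrow> real" where "e b \<omega> = of_bool (budget (\<tau> + 1) \<omega> = b)" for b \<omega>
  define U where "U \<omega> = (\<Sum>b\<in>{0..B}. e b \<omega> * final_bound b \<omega>)" for \<omega>
  have t: "1 \<le> \<tau> + 1" "\<tau> + 1 \<le> T + 1" using \<tau>_le by auto
  have me: "e b \<in> borel_measurable (coords {x. stage x < \<tau> + 1})" for b
    unfolding e_def[abs_def] by (rule budget_indicator_measurable) fact+
  have ie: "integrable \<Omega> (e b)" for b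
    by (rule integrable_bounded[OF measurable_coords_\<Omega>[OF me], of _ 1]) (simp add: e_def)
  have prod: "integrable \<Omega> (\<lambda>\<omega>. e b \<omega> * final_bound b \<omega>)"
    "outcome.expectation (\<lambda>\<omega>. e b \<omega> * final_bound b \<omega>) = outcome.expectation (e b) * outcome.expectation (final_bound b)" for b
    by (intro expectation_mult[OF _ me final_bound_measurable ie integrable_final_bound]; force)+
  have "integrable \<Omega> U"
    unfolding U_def[abs_def] by (intro Bochner_Integration.integrable_sum prod)
  moreover have "AE \<omega> in \<Omega>. value_to_go (\<tau> + 1) \<omega>
      - (\<Sum>t\<in>{\<tau>+1..<T+1}. \<omega> (Ability t) * of_bool (\<pi> t \<omega>)) \<le> U \<omega>"
    using AE_regular
  proof eventually_elim
    case (elim \<omega>)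
    have "U \<omega> = final_bound (budget (\<tau> + 1) \<omega>) \<omega>"
      unfolding U_def e_def sum_budget_indicator using budget_le by simp
    then show ?case using final_phase_loss_le[OF elim True] by simp
  qed
  moreover have "outcome.expectation U \<le> sqrt (T - \<tau>)"
  proof -
    have "outcome.expectation U = (\<Sum>b\<in>{0..B}. outcome.expectation (e b) * outcome.expectation (final_bound b))"
      unfolding U_def[abs_def] by (subst Bochner_Integration.integral_sum) (simp_all add: prod)
    also have "\<dots> \<le> (\<Sum>b\<in>{0..B}. outcome.expectation (e b) * sqrt (T - \<tau>))"
      by (intro sum_mono mult_left_mono expectation_final_bound_le True) (simp add: e_def)
    also have "\<dots> = (\<Sum>b\<in>{0..B}. outcome.expectation (e b)) * sqrt (T - \<tau>)" by (simp add: sum_distrib_right)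
    also have "\<dots> \<le> 1 * sqrt (T - \<tau>)"
      using sum_budget_probabilities_le[OF t, of 0]
      unfolding e_def[abs_def] by (intro mult_right_mono) simp_all
    finally show ?thesis by simp
  qed
  ultimately show ?thesis by blast
qed

lemma integrable_hindsight: "integrable \<Omega> (hindsight_optimum B T)"
proof (rule integrable_bounded[where c = T])
  have fin: "finite {A. A \<subseteq> {1..T} \<and> card A \<le> B}" by simp
  show "hindsight_optimum B T \<in> borel_measurable \<Omega>"
    unfolding hindsight_optimum_def[abs_def] using fin by (rule borel_measurable_Max) measurable
  show "AE \<omega> in \<Omega>. \<bar>hindsight_optimum B T \<omega>\<bar> \<le> real T"
    using AE_regular
  proof eventually_elim
    case (elim \<omega>)
    have "(\<Sum>t\<in>{}. \<omega> (Ability t)) \<le> hindsight_optimum B T \<omega>"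
      unfolding hindsight_optimum_def by (intro Max_ge finite_imageI fin imageI) auto
    moreover have "opt B (map (\<lambda>t. \<omega> (Ability t)) [1..<T+1]) \<le> length (map (\<lambda>t. \<omega> (Ability t)) [1..<T+1])"
      using elim by (intro conjunct2[OF opt_bounds]) (auto simp: regularD)
    moreover have "length (map (\<lambda>t. \<omega> (Ability t)) [1..<T+1]) = T" by simp
    ultimately show ?case using hindsight_optimum_le_opt[of B T \<omega>] by simp
  qed
qed

theorem regret_le_sum:
  assumes bound: "\<And>t b. t \<in> {1..\<tau>} \<Longrightarrow> 1 \<le> b \<Longrightarrow> \<exists>r. outcome.expectation (threshold_loss T t b r)
      + outcome.expectation (\<lambda>\<omega>. \<bar>mean_marginal T t b - estimate (K t) T t b \<omega>\<bar>) \<le> c t"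
    and nonneg: "\<And>t. t \<in> {1..\<tau>} \<Longrightarrow> 0 \<le> c t"
  shows "regret \<mu> B T \<pi> \<le> (\<Sum>t=1..\<tau>. c t) + sqrt (T - \<tau>)"
proof -
  have "\<forall>t\<in>{1..\<tau>}. \<exists>U. integrable \<Omega> U \<and> (AE \<omega> in \<Omega>. step_loss t \<omega> \<le> U \<omega>) \<and> outcome.expectation U \<le> c t"
    using expected_step_loss bound nonneg by blast
  then obtain U where U: "\<And>t. t \<in> {1..\<tau>} \<Longrightarrow> integrable \<Omega> (U t)"
    "\<And>t. t \<in> {1..\<tau>} \<Longrightarrow> AE \<omega> in \<Omega>. step_loss t \<omega> \<le> U t \<omega>"
    "\<And>t. t \<in> {1..\<tau>} \<Longrightarrow> outcome.expectation (U t) \<le> c t"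
    by metis
  obtain V where V: "integrable \<Omega> V" "AE \<omega> in \<Omega>. value_to_go (\<tau> + 1) \<omega>
      - (\<Sum>t\<in>{\<tau>+1..<T+1}. \<omega> (Ability t) * of_bool (\<pi> t \<omega>)) \<le> V \<omega>"
    "outcome.expectation V \<le> sqrt (T - \<tau>)"
    using expected_final_loss by blast
  define R where "R \<omega> = (\<Sum>t=1..T. \<omega> (Ability t) * of_bool (\<pi> t \<omega>))" for \<omega>
  have iR: "integrable \<Omega> R"
    unfolding R_def[abs_def]
  proof (rule Bochner_Integration.integrable_sum)
    fix t assume t: "t \<in> {1..T}"
    have [measurable]: "Measurable.pred \<Omega> (\<pi> t)"
      by (rule measurable_coords_\<Omega>[OF policy_measurable[OF t]])
    show "integrable \<Omega> (\<lambda>\<omega>. \<omega> (Ability t) * of_bool (\<pi> t \<omega>))"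
    proof (rule integrable_bounded[where c = 1])
      show "AE \<omega> in \<Omega>. \<bar>\<omega> (Ability t) * of_bool (\<pi> t \<omega>)\<bar> \<le> 1"
        using AE_unit_interval by eventually_elim (simp add: of_bool_def)
    qed measurable
  qed
  have "AE \<omega> in \<Omega>. \<forall>t\<in>{1..\<tau>}. step_loss t \<omega> \<le> U t \<omega>"
    using U(2) by (subst AE_ball_countable) (auto intro: countable_finite)
  with V(2) have pathwise: "AE \<omega> in \<Omega>. hindsight_optimum B T \<omega> - R \<omega> \<le> (\<Sum>t=1..\<tau>. U t \<omega>) + V \<omega>"
  proof eventually_elim
    case (elim \<omega>)
    have "hindsight_optimum B T \<omega> \<le> value_to_go 1 \<omega>"
      unfolding value_to_go_def budget_1 by (rule hindsight_optimum_le_opt)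
    moreover have "{1..T} = {1..\<tau>} \<union> {\<tau>+1..<T+1}" using \<tau>_le by auto
    then have "R \<omega> = (\<Sum>t=1..\<tau>. \<omega> (Ability t) * of_bool (\<pi> t \<omega>))
        + (\<Sum>t\<in>{\<tau>+1..<T+1}. \<omega> (Ability t) * of_bool (\<pi> t \<omega>))"
      unfolding R_def by (simp only:) (rule sum.union_disjoint; auto)
    moreover have "(\<Sum>t=1..\<tau>. step_loss t \<omega>) \<le> (\<Sum>t=1..\<tau>. U t \<omega>)"
      using elim by (intro sum_mono) blast
    ultimately show ?case using sum_step_loss[where n = \<tau> and \<omega> = \<omega>] elim by linarith
  qed
  have "regret \<mu> B T \<pi> = outcome.expectation (\<lambda>\<omega>. hindsight_optimum B T \<omega> - R \<omega>)"
    unfolding regret_def R_def[symmetric] using integrable_hindsight iR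
    by (subst Bochner_Integration.integral_diff) auto
  also have "\<dots> \<le> outcome.expectation (\<lambda>\<omega>. (\<Sum>t=1..\<tau>. U t \<omega>) + V \<omega>)"
    by (intro integral_mono_AE Bochner_Integration.integrable_diff Bochner_Integration.integrable_add
        Bochner_Integration.integrable_sum integrable_hindsight iR U(1) V(1) pathwise)
  also have "\<dots> = (\<Sum>t=1..\<tau>. outcome.expectation (U t)) + outcome.expectation V"
    using U(1) V(1) by (subst Bochner_Integration.integral_add)
      (auto intro!: Bochner_Integration.integrable_sum Bochner_Integration.integral_sum)
  also have "\<dots> \<le> (\<Sum>t=1..\<tau>. c t) + sqrt (T - \<tau>)"
    by (intro add_mono sum_mono U(3) V(3))
  finally show ?thesis .
qed

end

section \<open>Summation of the bounds\<close>

text \<open>The discrete counterpart of the derivative of \<open>x powr (1 - a)\<close>, from Young's inequality with one factor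
equal to one.\<close>
lemma powr_increment_ge:
  fixes a :: real
  assumes "0 < a" "a < 1"
  shows "(1 - a) * real (Suc n) powr (- a) \<le> real (Suc n) powr (1 - a) - real n powr (1 - a)"
proof (cases "n = 0")
  case False
  define x where "x = real (Suc n)"
  have x: "x > 0" and n: "real n = x - 1" "real n > 0" using False by (auto simp: x_def)
  have "(real n / x) powr (1 - a) * 1 powr a \<le> (1 - a) * (real n / x) + a * 1"
    using assms x n by (intro Youngs_inequality_0) auto
  also have "\<dots> = 1 - (1 - a) / x" using x by (simp add: n(1) field_simps)
  finally have "(real n / x) powr (1 - a) \<le> 1 - (1 - a) / x" by simp
  then have "real n powr (1 - a) / x powr (1 - a) \<le> 1 - (1 - a) / x"
    using x n by (simp add: powr_divide)
  then have "real n powr (1 - a) \<le> (1 - (1 - a) / x) * x powr (1 - a)"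
    using x by (simp add: pos_divide_le_eq)
  also have "\<dots> = x powr (1 - a) - (1 - a) * (x powr (1 - a) / x powr 1)"
    using x by (simp add: field_simps)
  also have "x powr (1 - a) / x powr 1 = x powr (- a)"
    using powr_diff[of x "1 - a" 1] by simp
  finally show ?thesis by (simp add: x_def)
qed (use assms in simp)

lemma sum_powr_le:
  fixes a :: real
  assumes "0 < a" "a < 1"
  shows "(\<Sum>s=1..n. real s powr (- a)) \<le> real n powr (1 - a) / (1 - a)"
proof -
  have "(1 - a) * (\<Sum>s=1..n. real s powr (- a)) \<le> real n powr (1 - a)"
  proof (induction n)
    case (Suc n)
    then show ?case using powr_increment_ge[OF assms, of n] by (simp add: distrib_left)
  qed simp
  then show ?thesis using assms by (simp add: pos_le_divide_eq mult.commute)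
qed

lemma sum_inverse_le:
  assumes "1 \<le> n"
  shows "(\<Sum>s=1..n. real s powr (- 1)) \<le> 1 + ln (real n)"
  using assms
proof (induction n rule: dec_induct)
  case (step n)
  have n: "real n > 0" using step by simp
  have "ln (real n / real (Suc n)) \<le> real n / real (Suc n) - 1"
    using n by (intro ln_le_minus_one) simp
  also have "real n / real (Suc n) - 1 = - (1 / real (Suc n))" by (simp add: field_simps)
  finally have "1 / real (Suc n) \<le> ln (real (Suc n)) - ln (real n)"
    using n by (simp add: ln_div)
  with step show ?case by (simp add: powr_minus_divide)
qed simp

lemma ln_2_ge_half: "1 / 2 \<le> ln (2 :: real)"
  using ln_le_minus_one[of "1 / 2 :: real"] by (simp add: ln_div)

text \<open>With \<open>y = s * \<epsilon>\<^sup>2\<close> the claim bounds \<open>y\<^sup>2 * exp (- y / 2)\<close> by a multiple of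
\<open>\<epsilon> ^ 4\<close>. The hypothesis says that \<open>(1 / \<epsilon>) ^ 4\<close> is at most a small power of \<open>exp y\<close>, which the
factor \<open>exp (- y / 2)\<close> absorbs.\<close>
lemma exp_tail_le:
  fixes \<epsilon> s :: real
  assumes "0 < \<epsilon>" "\<epsilon> \<le> 1" "1 \<le> s" "64 * ln (1 / \<epsilon>) / \<epsilon>\<^sup>2 - 1 \<le> s"
  shows "exp (- 2 * s * (\<epsilon> / 2)\<^sup>2) \<le> 256 * s powr (- 2)"
proof -
  define y where "y = s * \<epsilon>\<^sup>2"
  have y: "0 \<le> y" using assms by (simp add: y_def)
  have "\<epsilon>\<^sup>2 \<le> 1" using assms by (simp add: power_le_one)
  have "64 * ln (1 / \<epsilon>) / \<epsilon>\<^sup>2 * \<epsilon>\<^sup>2 \<le> (s + 1) * \<epsilon>\<^sup>2"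
    using assms(4) by (intro mult_right_mono) auto
  then have "64 * ln (1 / \<epsilon>) \<le> y + \<epsilon>\<^sup>2" using assms(1) by (simp add: y_def distrib_right)
  with \<open>\<epsilon>\<^sup>2 \<le> 1\<close> have "4 * ln (1 / \<epsilon>) \<le> y / 16 + 1 / 16" by simp
  then have "exp (4 * ln (1 / \<epsilon>)) \<le> exp (y / 16 + 1 / 16)" by simp
  moreover have "exp (4 * ln (1 / \<epsilon>)) = (1 / \<epsilon>) ^ 4"
    using assms(1) by (simp add: exp_of_nat_mult[of 4, simplified])
  ultimately have eps: "(1 / \<epsilon>) ^ 4 \<le> exp (y / 16 + 1 / 16)" by simp
  have "1 + y / 8 + (y / 8)\<^sup>2 / 2 \<le> exp (y / 8)" using y by (intro exp_lower_Taylor_quadratic) simp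
  then have ysq: "y\<^sup>2 \<le> 128 * exp (y / 8)" using y by (simp add: power_divide)
  have "s\<^sup>2 = y\<^sup>2 * (1 / \<epsilon>) ^ 4" using assms(1) by (simp add: y_def field_simps power_mult_distrib flip: power_mult)
  also have "\<dots> \<le> (128 * exp (y / 8)) * exp (y / 16 + 1 / 16)"
    using ysq eps by (intro mult_mono) auto
  finally have "s\<^sup>2 * exp (- y / 2) \<le> (128 * exp (y / 8)) * exp (y / 16 + 1 / 16) * exp (- y / 2)"
    by (intro mult_right_mono) auto
  also have "\<dots> = 128 * exp (1 / 16 - 5 * y / 16)"
    by (simp flip: exp_add)
  also have "\<dots> \<le> 128 * exp (ln 2)"
  proof (intro mult_left_mono exp_le_cancel_iff[THEN iffD2])
    show "1 / 16 - 5 * y / 16 \<le> ln 2" using y ln_2_ge_half by linarith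
  qed simp
  finally have "s\<^sup>2 * exp (- y / 2) \<le> 256" by simp
  then have "exp (- y / 2) \<le> 256 / s\<^sup>2" using assms(3) by (simp add: pos_le_divide_eq mult.commute)
  also have "256 / s\<^sup>2 = 256 * s powr (- 2)" using assms(3) by (simp add: powr_minus_divide)
  also have "- y / 2 = - 2 * s * (\<epsilon> / 2)\<^sup>2" by (simp add: y_def power2_eq_square)
  finally show ?thesis .
qed

text \<open>The window \<open>w\<close> makes the probability of a larger deviation at most \<open>2 / T\<^sup>2\<close>, so these
deviations contribute at most a constant in total.\<close>
definition step_bound :: "real \<Rightarrow> real \<Rightarrow> real \<Rightarrow> real \<Rightarrow> nat \<Rightarrow> nat \<Rightarrow> real" where
  "step_bound C0 \<beta> \<delta> \<kappa> T s = (let w = sqrt (ln (real T) / real s) in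
     2 * w * (\<bar>C0\<bar> * (2 * w) powr (1 / (\<beta> + 1)) + \<delta>) + 2 / (real T)\<^sup>2
       + 512 * real s powr (- 2) + real s powr (- \<kappa>))"

lemma step_bound_nonneg:
  assumes "0 \<le> \<delta>" "1 \<le> T"
  shows "0 \<le> step_bound C0 \<beta> \<delta> \<kappa> T s"
  using assms unfolding step_bound_def Let_def
  by (intro add_nonneg_nonneg mult_nonneg_nonneg divide_nonneg_nonneg) auto

text \<open>The step at time \<open>t\<close> has \<open>s = T - t\<close> candidates after it. The last step, with \<open>s = 0\<close>, is free of loss; this
is what makes the bound valid for \<open>T \<le> 1\<close>, where all logarithmic terms vanish.\<close>
lemma (in rams_policy) policy_regret_le:
  assumes "clustered C0 \<beta> \<epsilon>0 \<delta> \<mu>" "0 \<le> \<beta>" "0 < \<epsilon>0" "\<epsilon>0 \<le> 1" "0 \<le> \<delta>" "0 < \<kappa>"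
    and K: "\<And>t. t \<in> {1..\<tau>} \<Longrightarrow> real (T - t + 1) powr (2 * \<kappa>) \<le> real (K t)"
  shows "regret \<mu> B T \<pi> \<le> (\<Sum>s=1..T-1. step_bound C0 \<beta> \<delta> \<kappa> T s) + 8 * sqrt (ln (1 / \<epsilon>0)) / \<epsilon>0"
proof -
  define c where "c t = (if t < T then step_bound C0 \<beta> \<delta> \<kappa> T (T - t) else 0)" for t
  define X where "X = 64 * ln (1 / \<epsilon>0) / \<epsilon>0\<^sup>2"
  have X: "0 \<le> X" using assms(3,4) by (simp add: X_def)
  have tau: "\<tau> = T - nat \<lfloor>X\<rfloor>" by (simp add: switch_time_def X_def)
  have nonneg: "0 \<le> c t" for t
    using step_bound_nonneg[OF assms(5), of T] by (simp add: c_def)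
  have "regret \<mu> B T \<pi> \<le> (\<Sum>t=1..\<tau>. c t) + sqrt (T - \<tau>)"
  proof (rule regret_le_sum)
    fix t b assume t: "t \<in> {1..\<tau>}" and b: "1 \<le> (b :: nat)"
    show "\<exists>r. outcome.expectation (threshold_loss T t b r)
      + outcome.expectation (\<lambda>\<omega>. \<bar>mean_marginal T t b - estimate (K t) T t b \<omega>\<bar>) \<le> c t"
    proof (cases "b \<le> T - t")
      case False
      then show ?thesis using slack_budget_losses[of T t b "K t"] K_pos[OF t] nonneg[of t]
        by (intro exI[of _ "- 1"]) simp
    next
      case True
      then have less: "t < T" using b by simp
      define s where "s = real (T - t)"
      define w where "w = sqrt (ln (real T) / s)"
      have s: "1 \<le> s" using less by (simp add: s_def)
      have T: "2 \<le> T" using less t by simp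
      have w: "0 < w" using s T by (simp add: w_def)
      have w2: "s * w\<^sup>2 = ln (real T)" using s T by (simp add: w_def)
      obtain r where r: "outcome.expectation (threshold_loss T t b r)
        \<le> 2 * w * (\<bar>C0\<bar> * (2 * w) powr (1 / (\<beta> + 1)) + \<delta>)
          + 2 * exp (- 2 * s * w\<^sup>2) + 2 * exp (- 2 * s * (\<epsilon>0 / 2)\<^sup>2)"
        unfolding s_def by (rule expectation_threshold_loss_le[OF assms(1-3,5) w less b True])
      have "exp (- 2 * s * w\<^sup>2) = exp (- (2 * ln (real T)))" using w2 by simp
      also have "\<dots> = 1 / (real T)\<^sup>2"
        using T by (simp add: exp_minus exp_of_nat_mult[of 2, simplified] inverse_eq_divide)
      finally have e1: "exp (- 2 * s * w\<^sup>2) = 1 / (real T)\<^sup>2" .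
      \<comment> \<open>The adaptive phase ends early enough to leave at least \<open>nat \<lfloor>X\<rfloor>\<close> candidates.\<close>
      have "X - 1 \<le> s"
      proof -
        have "nat \<lfloor>X\<rfloor> \<le> T - t" using t unfolding tau by auto
        then have "real (nat \<lfloor>X\<rfloor>) \<le> s" by (simp add: s_def)
        then show ?thesis using X by linarith
      qed
      then have e2: "exp (- 2 * s * (\<epsilon>0 / 2)\<^sup>2) \<le> 256 * s powr (- 2)"
        unfolding X_def using assms s by (intro exp_tail_le) auto
      have "outcome.expectation (\<lambda>\<omega>. \<bar>mean_marginal T t b - estimate (K t) T t b \<omega>\<bar>) \<le> 1 / sqrt (K t)"
        using b K_pos[OF t] by (rule expectation_sampling_error_le)
      also have "\<dots> \<le> s powr (- \<kappa>)"
      proof -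
        have "s powr \<kappa> = sqrt (s powr (2 * \<kappa>))"
          by (simp add: powr_half_sqrt[symmetric] powr_powr)
        also have "\<dots> \<le> sqrt (K t)"
          using K[OF t] powr_mono2[of "2 * \<kappa>" s "real (T - t + 1)"] assms(6) s by (simp add: s_def)
        finally show ?thesis
          using s by (simp add: powr_minus_divide frac_le)
      qed
      finally have e3: "outcome.expectation (\<lambda>\<omega>. \<bar>mean_marginal T t b - estimate (K t) T t b \<omega>\<bar>) \<le> s powr (- \<kappa>)" .
      have "c t = 2 * w * (\<bar>C0\<bar> * (2 * w) powr (1 / (\<beta> + 1)) + \<delta>) + 2 / (real T)\<^sup>2
          + 512 * s powr (- 2) + s powr (- \<kappa>)"
        using less by (simp add: c_def step_bound_def Let_def s_def w_def)
      then show ?thesis using r e1 e2 e3 by (intro exI[of _ r]) simp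
    qed
  qed (rule nonneg)
  also have "(\<Sum>t=1..\<tau>. c t) \<le> (\<Sum>t=1..T. c t)"
    using \<tau>_le by (intro sum_mono2 nonneg) auto
  also have "(\<Sum>t=1..T. c t) = (\<Sum>s=0..<T. c (T - s))"
    by (rule sum.reindex_bij_witness[of _ "\<lambda>s. T - s" "\<lambda>t. T - t"]) auto
  also have "\<dots> = (\<Sum>s=1..T-1. step_bound C0 \<beta> \<delta> \<kappa> T s)"
    by (rule sum.mono_neutral_cong_right) (auto simp: c_def)
  also have "sqrt (T - \<tau>) \<le> 8 * sqrt (ln (1 / \<epsilon>0)) / \<epsilon>0"
  proof -
    have "real (T - \<tau>) \<le> X" using X unfolding tau by linarith
    then have "sqrt (T - \<tau>) \<le> sqrt X" by simp
    also have "sqrt X = sqrt (8\<^sup>2) * sqrt (ln (1 / \<epsilon>0)) / sqrt (\<epsilon>0\<^sup>2)"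
      unfolding X_def real_sqrt_divide real_sqrt_mult by simp
    also have "\<dots> = 8 * sqrt (ln (1 / \<epsilon>0)) / \<epsilon>0" using assms(3) by simp
    finally show ?thesis .
  qed
  finally show ?thesis by simp
qed

definition zeta_sum :: "real \<Rightarrow> real" where
  "zeta_sum \<kappa> = (\<Sum>n. real n powr (- \<kappa>))"

lemma sum_powr_le_zeta_sum:
  assumes "1 < \<kappa>"
  shows "(\<Sum>s=1..n. real s powr (- \<kappa>)) \<le> zeta_sum \<kappa>"
  unfolding zeta_sum_def
  by (rule sum_le_suminf) (use assms in \<open>auto simp: summable_real_powr_iff\<close>)

lemma zeta_sum_nonneg: "1 < \<kappa> \<Longrightarrow> 0 \<le> zeta_sum \<kappa>"
  using sum_powr_le_zeta_sum[of \<kappa> 0] by simp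

lemma sum_step_bound_le:
  fixes C0 \<beta> \<delta> \<kappa> :: real
  assumes "0 \<le> \<beta>" "0 \<le> \<delta>" "1 < \<kappa>" "2 \<le> T"
  defines "a \<equiv> 1 / 2 + 1 / (2 * (\<beta> + 1))"
  shows "(\<Sum>s=1..T-1. step_bound C0 \<beta> \<delta> \<kappa> T s) \<le>
     4 * \<bar>C0\<bar> * ln (real T) powr a * (\<Sum>s=1..T. real s powr (- a))
     + 4 * \<delta> * sqrt (real T * ln (real T)) + (1 + 512 * zeta_sum 2 + zeta_sum \<kappa>)"
proof -
  define h where "h = 1 / (\<beta> + 1)"
  have h: "0 < h" "h \<le> 1" using assms(1) by (auto simp: h_def)
  have a: "a = (1 + h) / 2" by (simp add: a_def h_def add_divide_distrib)
  have lnT: "0 < ln (real T)" using assms(4) by simp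
  have per_step: "step_bound C0 \<beta> \<delta> \<kappa> T s \<le> 4 * \<bar>C0\<bar> * ln (real T) powr a * real s powr (- a)
      + 2 * \<delta> * sqrt (ln (real T)) * real s powr (- (1 / 2)) + 2 / (real T)\<^sup>2
      + 512 * real s powr (- 2) + real s powr (- \<kappa>)" if s: "1 \<le> s" for s
  proof -
    define q where "q = ln (real T) / real s"
    have q: "0 < q" using lnT s by (simp add: q_def)
    define w where "w = sqrt q"
    have w: "0 < w" using q by (simp add: w_def)
    have "2 * w * (2 * w) powr h = (2 * w) powr (1 + h)" using w by (simp add: powr_add)
    also have "\<dots> = 2 powr (1 + h) * w powr (1 + h)" using w by (simp add: powr_mult)
    also have "w powr (1 + h) = q powr a"
      unfolding w_def powr_half_sqrt[OF less_imp_le[OF q], symmetric] powr_powr a by simp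
    also have "q powr a = ln (real T) powr a * real s powr (- a)"
      using lnT s by (simp add: q_def powr_divide powr_minus_divide)
    also have "2 powr (1 + h) * (ln (real T) powr a * real s powr (- a))
        \<le> 2 powr 2 * (ln (real T) powr a * real s powr (- a))"
      using h by (intro mult_right_mono powr_mono) auto
    finally have "2 * w * (2 * w) powr h \<le> 4 * (ln (real T) powr a * real s powr (- a))" by simp
    then have main: "\<bar>C0\<bar> * (2 * w * (2 * w) powr h) \<le> \<bar>C0\<bar> * (4 * (ln (real T) powr a * real s powr (- a)))"
      by (intro mult_left_mono) auto
    have wd: "w = sqrt (ln (real T)) * real s powr (- (1 / 2))"
      using s by (simp add: w_def q_def real_sqrt_divide powr_minus_divide powr_half_sqrt)
    have "step_bound C0 \<beta> \<delta> \<kappa> T s = \<bar>C0\<bar> * (2 * w * (2 * w) powr h) + 2 * \<delta> * w + 2 / (real T)\<^sup>2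
      + 512 * real s powr (- 2) + real s powr (- \<kappa>)"
      unfolding step_bound_def Let_def w_def q_def h_def by (simp add: algebra_simps)
    also have "2 * \<delta> * w = 2 * \<delta> * sqrt (ln (real T)) * real s powr (- (1 / 2))"
      by (simp add: wd)
    finally show ?thesis using main by (simp add: mult.assoc mult.left_commute)
  qed
  have "(\<Sum>s=1..T-1. step_bound C0 \<beta> \<delta> \<kappa> T s) \<le>
      (\<Sum>s=1..T-1. 4 * \<bar>C0\<bar> * ln (real T) powr a * real s powr (- a)
      + 2 * \<delta> * sqrt (ln (real T)) * real s powr (- (1 / 2)) + 2 / (real T)\<^sup>2
      + 512 * real s powr (- 2) + real s powr (- \<kappa>))"
    by (intro sum_mono per_step) simp
  also have "\<dots> = 4 * \<bar>C0\<bar> * ln (real T) powr a * (\<Sum>s=1..T-1. real s powr (- a))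
      + 2 * \<delta> * sqrt (ln (real T)) * (\<Sum>s=1..T-1. real s powr (- (1 / 2))) + real (T - 1) * (2 / (real T)\<^sup>2)
      + 512 * (\<Sum>s=1..T-1. real s powr (- 2)) + (\<Sum>s=1..T-1. real s powr (- \<kappa>))"
    by (simp add: sum.distrib sum_distrib_left)
  also have "\<dots> \<le> 4 * \<bar>C0\<bar> * ln (real T) powr a * (\<Sum>s=1..T. real s powr (- a))
      + 2 * \<delta> * sqrt (ln (real T)) * (2 * sqrt (real T)) + 1 + 512 * zeta_sum 2 + zeta_sum \<kappa>"
  proof (intro add_mono mult_left_mono sum_powr_le_zeta_sum assms(3))
    show "(\<Sum>s=1..T-1. real s powr (- a)) \<le> (\<Sum>s=1..T. real s powr (- a))"
      by (intro sum_mono2) auto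
    have "(\<Sum>s=1..T-1. real s powr (- (1 / 2))) \<le> (\<Sum>s=1..T. real s powr (- (1 / 2)))"
      by (intro sum_mono2) auto
    also have "\<dots> \<le> real T powr (1 - 1 / 2) / (1 - 1 / 2)" by (rule sum_powr_le) auto
    also have "\<dots> = 2 * sqrt (real T)" by (simp add: powr_half_sqrt)
    finally show "(\<Sum>s=1..T-1. real s powr (- (1 / 2))) \<le> 2 * sqrt (real T)" .
    have "real (T - 1) * (2 / (real T)\<^sup>2) \<le> real T * (2 / (real T)\<^sup>2)"
      by (intro mult_right_mono) auto
    also have "\<dots> = 2 / real T" using assms(4) by (simp add: power2_eq_square)
    also have "\<dots> \<le> 1" using assms(4) by simp
    finally show "real (T - 1) * (2 / (real T)\<^sup>2) \<le> 1" .
  qed (use assms(2) lnT in auto)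
  also have "2 * \<delta> * sqrt (ln (real T)) * (2 * sqrt (real T)) = 4 * \<delta> * sqrt (real T * ln (real T))"
    by (simp add: real_sqrt_mult)
  finally show ?thesis by simp
qed

text \<open>Here \<open>R\<close> is the leading term of the final bound. Its comparison with the constant one, available from
\<open>T = 2\<close> on, allows constants to be absorbed into it.\<close>
lemma main_sum_le:
  fixes \<beta> :: real
  assumes "0 \<le> \<beta>" "2 \<le> T"
  defines "a \<equiv> 1 / 2 + 1 / (2 * (\<beta> + 1))"
  defines "R \<equiv> (1 + 1 / \<beta>) * ln (real T) powr a * real T powr (1 / 2 - 1 / (2 * (\<beta> + 1))) * of_bool (\<beta> > 0)
      + (ln (real T))\<^sup>2 * of_bool (\<beta> = 0)"
  shows "ln (real T) powr a * (\<Sum>s=1..T. real s powr (- a)) \<le> 3 * R" and "1 \<le> 4 * R"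
proof -
  have half: "1 / 2 \<le> ln (real T)"
    using ln_2_ge_half ln_mono[of 2 "real T"] assms(2) by linarith
  have "ln (real T) powr a * (\<Sum>s=1..T. real s powr (- a)) \<le> 3 * R \<and> 1 \<le> 4 * R"
  proof (cases "\<beta> = 0")
    case True
    then have a: "a = 1" and R: "R = (ln (real T))\<^sup>2" by (simp_all add: a_def R_def)
    have "ln (real T) * (\<Sum>s=1..T. real s powr (- 1)) \<le> ln (real T) * (1 + ln (real T))"
      using half assms(2) by (intro mult_left_mono sum_inverse_le) auto
    also have "\<dots> \<le> ln (real T) * (3 * ln (real T))"
      using half by (intro mult_left_mono) auto
    finally have "ln (real T) * (\<Sum>s=1..T. real s powr (- 1)) \<le> 3 * R" by (simp add: R power2_eq_square)
    moreover have "(1 / 2)\<^sup>2 \<le> (ln (real T))\<^sup>2" using half by (intro power_mono) auto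
    ultimately show ?thesis using half by (simp add: a R power2_eq_square)
  next
    case False
    then have pos: "0 < \<beta>" using assms(1) by simp
    define x where "x = (1 + 1 / \<beta>) * ln (real T) powr a * real T powr (1 - a)"
    have ra: "1 / 2 - 1 / (2 * (\<beta> + 1)) = 1 - a" by (simp add: a_def)
    have R: "R = x" using pos by (simp only: R_def x_def ra) simp
    have inv: "1 / (1 - a) = 2 * (1 + 1 / \<beta>)" using pos by (simp add: a_def field_simps)
    have a: "1 / 2 < a" "a < 1" using pos by (auto simp: a_def field_simps)
    have "ln (real T) powr a * (\<Sum>s=1..T. real s powr (- a)) \<le> ln (real T) powr a * (real T powr (1 - a) / (1 - a))"
      using a by (intro mult_left_mono sum_powr_le) auto
    also have "real T powr (1 - a) / (1 - a) = real T powr (1 - a) * (2 * (1 + 1 / \<beta>))"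
      unfolding inv[symmetric] by simp
    also have "ln (real T) powr a * \<dots> = 2 * x" by (simp add: x_def)
    finally have main: "ln (real T) powr a * (\<Sum>s=1..T. real s powr (- a)) \<le> 2 * x" .
    have "1 / 2 = (1 / 2 :: real) powr 1" by simp
    also have "\<dots> \<le> (1 / 2) powr a" using a by (intro powr_mono') auto
    also have "\<dots> \<le> ln (real T) powr a" using half a by (intro powr_mono2) auto
    finally have l: "1 / 2 \<le> ln (real T) powr a" .
    have "1 * (1 / 2) * 1 \<le> x"
      unfolding x_def using pos l a assms(2) by (intro mult_mono ge_one_powr_ge_zero) auto
    then show ?thesis using main by (simp add: R)
  qed
  then show "ln (real T) powr a * (\<Sum>s=1..T. real s powr (- a)) \<le> 3 * R" "1 \<le> 4 * R" by blast+
qed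

theorem mainTheorem7:
  fixes \<mu> :: "real measure" and C0 \<eta> \<nu> :: real
  assumes "real_distribution \<mu>" and "measure \<mu> {0..1} = 1"
    and "\<eta> > 2" and "\<nu> > 0"
  shows "\<exists>C::real. \<forall>(\<beta>::real) (\<epsilon>0::real) (\<delta>::real).
    0 \<le> \<beta> \<and> 0 < \<epsilon>0 \<and> \<epsilon>0 \<le> 1 \<and> 0 \<le> \<delta> \<and> \<delta> \<le> 1 \<and> clustered C0 \<beta> \<epsilon>0 \<delta> \<mu> \<longrightarrow>
    (\<forall>(T::nat) (B::nat) (K :: nat \<Rightarrow> nat) (\<pi> :: policy).
       (\<forall>t\<in>{1..switch_time \<epsilon>0 T}. real (K t) \<ge> real (T - t + 1) powr (\<eta> + \<nu>)) \<and>
       rams \<mu> \<epsilon>0 K B T \<pi> \<longrightarrow>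
       regret \<mu> B T \<pi> \<le>
         C * (1 + 1 / \<beta>) * ln (real T) powr (1 / 2 + 1 / (2 * (\<beta> + 1)))
           * real T powr (1 / 2 - 1 / (2 * (\<beta> + 1))) * of_bool (\<beta> > 0)
         + C * (ln (real T))\<^sup>2 * of_bool (\<beta> = 0)
         + C * \<delta> * sqrt (real T * ln (real T))
         + C * sqrt (ln (1 / \<epsilon>0)) / \<epsilon>0)"
proof -
  define \<kappa> where "\<kappa> = (\<eta> + \<nu>) / 2"
  define A where "A = 1 + 512 * zeta_sum 2 + zeta_sum \<kappa>"
  define C where "C = 12 * \<bar>C0\<bar> + 4 * A + 8"
  have \<kappa>: "1 < \<kappa>" using assms by (simp add: \<kappa>_def)
  have A: "0 \<le> A" using zeta_sum_nonneg[of 2] zeta_sum_nonneg[OF \<kappa>] by (simp add: A_def)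
  show ?thesis
  proof (intro exI[of _ C] allI impI, elim conjE)
    fix \<beta> \<epsilon>0 \<delta> :: real and T B :: nat and K :: "nat \<Rightarrow> nat" and \<pi> :: policy
    assume \<beta>: "0 \<le> \<beta>" and \<epsilon>0: "0 < \<epsilon>0" "\<epsilon>0 \<le> 1" and \<delta>: "0 \<le> \<delta>" "\<delta> \<le> 1"
      and clustered: "clustered C0 \<beta> \<epsilon>0 \<delta> \<mu>"
      and K: "\<forall>t\<in>{1..switch_time \<epsilon>0 T}. real (K t) \<ge> real (T - t + 1) powr (\<eta> + \<nu>)"
      and rams: "rams \<mu> \<epsilon>0 K B T \<pi>"
    define a where "a = 1 / 2 + 1 / (2 * (\<beta> + 1))"
    define R where "R = (1 + 1 / \<beta>) * ln (real T) powr a * real T powr (1 / 2 - 1 / (2 * (\<beta> + 1))) * of_bool (\<beta> > 0)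
      + (ln (real T))\<^sup>2 * of_bool (\<beta> = 0)"
    define Q where "Q = \<delta> * sqrt (real T * ln (real T))"
    define E where "E = sqrt (ln (1 / \<epsilon>0)) / \<epsilon>0"
    have K_pos: "1 \<le> K t" if t: "t \<in> {1..switch_time \<epsilon>0 T}" for t
    proof -
      have "0 < real (T - t + 1) powr (\<eta> + \<nu>)" by simp
      also have "\<dots> \<le> real (K t)" using K t by blast
      finally show ?thesis by simp
    qed
    have "ability_law \<mu>" by (rule ability_law.intro) (rule assms)+
    then interpret rams_policy \<mu> \<epsilon>0 K B T \<pi>
      by (rule rams_policy.intro) (rule rams_policy_axioms.intro[OF rams K_pos])
    have "2 * \<kappa> = \<eta> + \<nu>" by (simp add: \<kappa>_def)
    with K have "real (T - t + 1) powr (2 * \<kappa>) \<le> real (K t)" if "t \<in> {1..\<tau>}" for t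
      using that by (simp only:)
    then have regret: "regret \<mu> B T \<pi> \<le> (\<Sum>s=1..T-1. step_bound C0 \<beta> \<delta> \<kappa> T s) + 8 * E"
      using policy_regret_le[OF clustered \<beta> \<epsilon>0 \<delta>(1), of \<kappa>] \<kappa> unfolding E_def by simp
    have R: "0 \<le> R"
      unfolding R_def using \<beta> by (intro add_nonneg_nonneg mult_nonneg_nonneg) auto
    have "0 \<le> ln (real T)" by (cases "T = 0") auto
    then have Q: "0 \<le> Q" unfolding Q_def using \<delta> by (intro mult_nonneg_nonneg real_sqrt_ge_zero) auto
    have E: "0 \<le> E" unfolding E_def using \<epsilon>0 by simp
    note nonneg = R Q E
    have "(\<Sum>s=1..T-1. step_bound C0 \<beta> \<delta> \<kappa> T s) \<le> (12 * \<bar>C0\<bar> + 4 * A) * R + 4 * Q"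
    proof (cases "2 \<le> T")
      case True
      note m = main_sum_le[OF \<beta> True, folded a_def, folded R_def]
      have "(\<Sum>s=1..T-1. step_bound C0 \<beta> \<delta> \<kappa> T s)
          \<le> 4 * \<bar>C0\<bar> * (ln (real T) powr a * (\<Sum>s=1..T. real s powr (- a))) + 4 * Q + A * 1"
        using sum_step_bound_le[OF \<beta> \<delta>(1) \<kappa> True, of C0] unfolding a_def A_def Q_def by (simp add: mult.assoc)
      also have "\<dots> \<le> 4 * \<bar>C0\<bar> * (3 * R) + 4 * Q + A * (4 * R)"
        using m A by (intro add_mono mult_left_mono order_refl) auto
      finally show ?thesis by (simp add: algebra_simps)
    next
      case False
      then have "{1..T-1} = {}" by auto
      then show ?thesis using nonneg A by simp
    qed
    also have "\<dots> \<le> C * R + C * Q"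
      using nonneg A by (intro add_mono mult_right_mono) (auto simp: C_def)
    finally have "regret \<mu> B T \<pi> \<le> C * R + C * Q + 8 * E" using regret by linarith
    moreover have "8 * E \<le> C * E" using nonneg A by (intro mult_right_mono) (auto simp: C_def)
    ultimately have "regret \<mu> B T \<pi> \<le> C * R + C * Q + C * E" by linarith
    then show "regret \<mu> B T \<pi> \<le>
         C * (1 + 1 / \<beta>) * ln (real T) powr (1 / 2 + 1 / (2 * (\<beta> + 1)))
           * real T powr (1 / 2 - 1 / (2 * (\<beta> + 1))) * of_bool (\<beta> > 0)
         + C * (ln (real T))\<^sup>2 * of_bool (\<beta> = 0)
         + C * \<delta> * sqrt (real T * ln (real T))
         + C * sqrt (ln (1 / \<epsilon>0)) / \<epsilon>0"
      unfolding R_def Q_def E_def a_def by (simp only: mult.assoc times_divide_eq_right) (simp only: distrib_left[of C])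
  qed
qed

end
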